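(* Let $E_0,E_1,E_2$ be infinite dimensional Banach spaces and let $B:K(E_0,E_1)\times E_0\to E_1$ be the bilinear mapping $B(X,y)=Xy$. Then $B$ is weakly sequentially continuous (i.e. if $X_n\to X$ weakly in $K(E_0,E_1)$ and $y_n\to y$ weakly in $E_0$, then $B(X_n,y_n)\to B(X,y)$ weakly in $E_1$) if and only if $E_0$ has the Dunford–Pettis property. In this case, let $C\subset K(E_0,E_1)$ and $D\subset E_0$ be nonempty closed convex weakly compact sets, $A\in C$, $T\in L(E_0,E_2)$, $b\in E_1$, and let $f:\mathbb R_{\ge0}^3\to\mathbb R_{\ge0}$ be continuous, increasing (in each variable) and coercive. Then the problem $$\min_{X\in C,\ x\in D}\ f\big(\|Tx\|_{E_2},\ \|A-X\|,\ \|Xx-b\|_{E_1}\big)$$ admits a solution, i.e. the minimum is attained.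
   Context: $K(E_0,E_1)$ is the space of compact operators from $E_0$ to $E_1$ with the operator norm. A Banach space $E_0$ has the Dunford–Pettis property if for every Banach space $Z$, every weakly compact linear operator $S:E_0\to Z$ maps weakly compact sets onto norm compact sets. $f$ coercive means $f(t)\to\infty$ as $\|t\|\to\infty$ in $\mathbb R_{\ge0}^3$. *)

theory Defs
  imports "HOL-Analysis.Analysis" "HOL-Probability.Discrete_Topology"
begin

definition infinite_dimensional :: "'a::real_vector itself \<Rightarrow> bool"
  where "infinite_dimensional _ \<longleftrightarrow> \<not> (\<exists>B::'a set. finite B \<and> span B = UNIV)"


section \<open>The weak topology\<close>

text \<open>The initial topology with respect to all continuous linear functionals.\<close>

definition weak_topology :: "'a::real_normed_vector topology"
  where "weak_topology =
    pullback_topology UNIV (\<lambda>x. \<lambda>\<phi>::'a \<Rightarrow>\<^sub>L real. blinfun_apply \<phi> x) euclidean"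

abbreviation weakly_compact :: "'a::real_normed_vector set \<Rightarrow> bool"
  where "weakly_compact A \<equiv> compactin weak_topology A"

abbreviation weakly_tendsto :: "(nat \<Rightarrow> 'a::real_normed_vector) \<Rightarrow> 'a \<Rightarrow> bool"
  where "weakly_tendsto X x \<equiv> limitin weak_topology X x sequentially"

lemma topspace_weak_topology [simp]: "topspace weak_topology = UNIV"
  by (simp add: weak_topology_def topspace_pullback_topology)

lemma continuous_map_into_weak_topology:
  fixes g :: "'b \<Rightarrow> 'a::real_normed_vector"
  assumes "\<And>\<phi>::'a \<Rightarrow>\<^sub>L real. continuous_map T euclideanreal (\<lambda>x. \<phi> (g x))"
  shows "continuous_map T weak_topology g"
  unfolding weak_topology_def
proof (rule continuous_map_pullback')
  have "continuous_map T (product_topology (\<lambda>_. euclideanreal) UNIV)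
          (\<lambda>x. \<lambda>\<phi>::'a \<Rightarrow>\<^sub>L real. \<phi> (g x))"
    using assms by (simp add: continuous_map_componentwise_UNIV)
  then show "continuous_map T euclidean ((\<lambda>x. \<lambda>\<phi>::'a \<Rightarrow>\<^sub>L real. blinfun_apply \<phi> x) \<circ> g)"
    by (simp add: o_def euclidean_product_topology)
qed auto

lemma continuous_map_weak_functional:
  fixes \<phi> :: "'a::real_normed_vector \<Rightarrow>\<^sub>L real"
  shows "continuous_map weak_topology euclideanreal (blinfun_apply \<phi>)"
proof -
  have "continuous_map (euclidean :: (('a \<Rightarrow>\<^sub>L real) \<Rightarrow> real) topology) euclideanreal (\<lambda>h. h \<phi>)"
    using continuous_map_product_projection[of \<phi> UNIV "\<lambda>_. euclideanreal"]
    by (simp add: euclidean_product_topology)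
  from continuous_map_pullback[OF this, of UNIV "\<lambda>x. \<lambda>\<phi>::'a \<Rightarrow>\<^sub>L real. blinfun_apply \<phi> x"]
  show ?thesis
    by (simp add: weak_topology_def o_def)
qed

lemma weakly_tendsto_iff:
  fixes X :: "nat \<Rightarrow> 'a::real_normed_vector"
  shows "weakly_tendsto X x \<longleftrightarrow> (\<forall>\<phi>::'a \<Rightarrow>\<^sub>L real. (\<lambda>n. \<phi> (X n)) \<longlonglongrightarrow> \<phi> x)"
proof safe
  fix \<phi> :: "'a \<Rightarrow>\<^sub>L real"
  assume "weakly_tendsto X x"
  from continuous_map_limit[OF continuous_map_weak_functional[of \<phi>] this]
  show "(\<lambda>n. \<phi> (X n)) \<longlonglongrightarrow> \<phi> x"
    by (simp add: o_def)
next
  assume *: "\<forall>\<phi>::'a \<Rightarrow>\<^sub>L real. (\<lambda>n. \<phi> (X n)) \<longlonglongrightarrow> \<phi> x"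
  let ?i = "\<lambda>x. \<lambda>\<phi>::'a \<Rightarrow>\<^sub>L real. blinfun_apply \<phi> x"
  have lim: "((\<lambda>n. ?i (X n)) \<longlongrightarrow> ?i x) sequentially"
  proof -
    have "limitin (product_topology (\<lambda>_. euclideanreal) UNIV) (\<lambda>n. ?i (X n)) (?i x) sequentially"
      using * by (simp add: limitin_componentwise)
    then show ?thesis
      by (simp add: euclidean_product_topology)
  qed
  show "weakly_tendsto X x"
    unfolding limitin_def
  proof (intro conjI allI impI)
    fix U assume "openin weak_topology U \<and> x \<in> U"
    then obtain V where V: "open V" "U = ?i -` V" "x \<in> U"
      unfolding weak_topology_def openin_pullback_topology by auto
    then have "\<forall>\<^sub>F n in sequentially. ?i (X n) \<in> V"
      using topological_tendstoD[OF lim, of V] by auto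
    then show "\<forall>\<^sub>F n in sequentially. X n \<in> U"
      using V by auto
  qed auto
qed

lemma continuous_map_weak_blinfun:
  fixes J :: "'a::real_normed_vector \<Rightarrow>\<^sub>L 'b::real_normed_vector"
  shows "continuous_map weak_topology weak_topology (blinfun_apply J)"
proof (rule continuous_map_into_weak_topology)
  fix \<phi> :: "'b \<Rightarrow>\<^sub>L real"
  show "continuous_map weak_topology euclideanreal (\<lambda>x. \<phi> (J x))"
    using continuous_map_weak_functional[of "\<phi> o\<^sub>L J"]
    by (simp add: blinfun_compose.rep_eq o_def)
qed


section \<open>Weakly sequentially continuous maps and the Dunford--Pettis property\<close>

definition weakly_seq_continuous2 ::
    "('a::real_normed_vector \<Rightarrow> 'b::real_normed_vector \<Rightarrow> 'c::real_normed_vector) \<Rightarrow> bool"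
  where "weakly_seq_continuous2 B \<longleftrightarrow>
    (\<forall>X x Y y. weakly_tendsto X x \<longrightarrow> weakly_tendsto Y y \<longrightarrow>
       weakly_tendsto (\<lambda>n. B (X n) (Y n)) (B x y))"

definition weakly_compact_operator ::
    "('a::real_normed_vector \<Rightarrow>\<^sub>L 'b::real_normed_vector) \<Rightarrow> bool"
  where "weakly_compact_operator S \<longleftrightarrow>
    (\<forall>A. bounded A \<longrightarrow> weakly_compact (weak_topology closure_of (blinfun_apply S ` A)))"

text \<open>The condition in the Dunford--Pettis property of \<open>'a\<close> for one target space \<open>'z\<close>.\<close>

definition dunford_pettis_into :: "'a::banach itself \<Rightarrow> 'z::banach itself \<Rightarrow> bool"
  where "dunford_pettis_into _ _ \<longleftrightarrow>
    (\<forall>S::'a \<Rightarrow>\<^sub>L 'z. weakly_compact_operator S \<longrightarrow>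
       (\<forall>W. weakly_compact W \<longrightarrow> compact (blinfun_apply S ` W)))"

instance bcontfun :: (metric_space, banach) banach ..

text \<open>
  The property quantifies over all Banach spaces, which a formula of HOL cannot do. It is therefore
  stated for the single target \<open>\<ell>\<^sup>\<infinity>('a)\<close>, the bounded functions on the discrete
  set underlying \<open>'a\<close>. This loses nothing: lemma \<open>dunford_pettis_imp_into\<close> below
  derives the condition for every Banach space \<open>'z\<close>, because the range of an operator on
  \<open>'a\<close> is mapped isometrically into \<open>\<ell>\<^sup>\<infinity>('a)\<close> by norming functionals.
\<close>

definition dunford_pettis :: "'a::banach itself \<Rightarrow> bool"
  where "dunford_pettis _ \<longleftrightarrow> dunford_pettis_into TYPE('a) TYPE('a discrete \<Rightarrow>\<^sub>C real)"


subsection \<open>Norming functionals (Hahn--Banach)\<close>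

definition sublin :: "('a::real_normed_vector \<Rightarrow> real) \<Rightarrow> bool"
  where "sublin p \<longleftrightarrow> (\<forall>x y. p (x + y) \<le> p x + p y) \<and> (\<forall>c x. 0 < c \<longrightarrow> p (c *\<^sub>R x) = c * p x)
     \<and> (\<forall>x. p x \<le> norm x)"

lemma sublin_lower: "sublin p \<Longrightarrow> - norm x \<le> p x"
proof -
  assume p: "sublin p"
  have "p (2 *\<^sub>R (0::'a)) = 2 * p 0"
    using p unfolding sublin_def by (metis zero_less_numeral)
  then have "p 0 = 0" by simp
  moreover have "p (x + - x) \<le> p x + p (- x)" "p (- x) \<le> norm (- x)"
    using p unfolding sublin_def by blast+
  ultimately show ?thesis by simp
qed

lemma sublin_INF:
  assumes "I \<noteq> {}" and p: "\<And>i. i \<in> I \<Longrightarrow> sublin (p i)"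
    and dir: "\<And>i j x y. i \<in> I \<Longrightarrow> j \<in> I \<Longrightarrow> \<exists>k\<in>I. p k (x + y) \<le> p i x + p j y"
  shows "sublin (\<lambda>x. INF i\<in>I. p i x)"
proof -
  have bdd: "bdd_below ((\<lambda>i. p i x) ` I)" for x
    using sublin_lower[OF p] by (auto intro!: bdd_belowI[of _ "- norm x"])
  have add: "(INF i\<in>I. p i (x + y)) \<le> (INF i\<in>I. p i x) + (INF i\<in>I. p i y)" for x y
  proof -
    have 1: "(INF i\<in>I. p i (x + y)) \<le> p i x + p j y" if "i \<in> I" "j \<in> I" for i j
      using dir[OF that, of x y] cINF_lower[OF bdd, of _ "x + y"] by (meson order_trans)
    have "(INF i\<in>I. p i (x + y)) - p i x \<le> (INF j\<in>I. p j y)" if "i \<in> I" for i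
    proof (rule cINF_greatest[OF assms(1)])
      fix j assume "j \<in> I"
      from 1[OF that this] show "(INF i\<in>I. p i (x + y)) - p i x \<le> p j y" by simp
    qed
    then have 2: "(INF i\<in>I. p i (x + y)) - (INF j\<in>I. p j y) \<le> p i x" if "i \<in> I" for i
      using that by (simp add: algebra_simps)
    have "(INF i\<in>I. p i (x + y)) - (INF j\<in>I. p j y) \<le> (INF i\<in>I. p i x)"
      by (rule cINF_greatest[OF assms(1)]) (rule 2)
    then show ?thesis by simp
  qed
  have le: "c * (INF i\<in>I. p i x) \<le> (INF i\<in>I. p i (c *\<^sub>R x))" if "c > 0" for c x
  proof (rule cINF_greatest[OF assms(1)])
    fix i assume "i \<in> I"
    then show "c * (INF i\<in>I. p i x) \<le> p i (c *\<^sub>R x)"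
      using p[of i] cINF_lower[OF bdd, of i x] that by (simp add: sublin_def)
  qed
  have hom: "(INF i\<in>I. p i (c *\<^sub>R x)) = c * (INF i\<in>I. p i x)" if c: "c > 0" for c x
  proof (rule antisym[OF _ le[OF c]])
    have "inverse c * (INF i\<in>I. p i (c *\<^sub>R x)) \<le> (INF i\<in>I. p i x)"
      using le[of "inverse c" "c *\<^sub>R x"] c by simp
    then show "(INF i\<in>I. p i (c *\<^sub>R x)) \<le> c * (INF i\<in>I. p i x)"
      using c by (simp add: field_simps)
  qed
  have norm: "(INF i\<in>I. p i x) \<le> norm x" for x
  proof -
    obtain i where i: "i \<in> I" using assms(1) by auto
    have "(INF i\<in>I. p i x) \<le> p i x" by (rule cINF_lower[OF bdd i])
    also have "\<dots> \<le> norm x" using p[OF i] by (simp add: sublin_def)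
    finally show ?thesis .
  qed
  show ?thesis
    unfolding sublin_def using add hom norm by blast
qed

lemma sublin_reduce:
  assumes p: "sublin p"
  obtains q where "sublin q" "\<And>x. q x \<le> p x" "q (- y) \<le> - p y"
proof
  let ?r = "\<lambda>t x. p (x + t *\<^sub>R y) - t * p y"
  let ?q = "\<lambda>x. INF t\<in>{0..}. ?r t x"
  have sub: "p (u + v) \<le> p u + p v" for u v
    using p by (simp add: sublin_def)
  have hom: "p (c *\<^sub>R u) = c * p u" if "c > 0" for c u
    using p that by (simp add: sublin_def)
  have p0: "p 0 = 0"
    using hom[of 2 0] by simp
  have hom': "p (c *\<^sub>R u) = c * p u" if "c \<ge> 0" for c u
    using hom[of c u] p0 that by (cases "c = 0") auto
  have lower: "- norm x \<le> ?r t x" if "t \<ge> 0" for t x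
  proof -
    have "t * p y = p ((x + t *\<^sub>R y) + - x)" using hom'[OF that] by simp
    also have "\<dots> \<le> p (x + t *\<^sub>R y) + p (- x)" by (rule sub)
    also have "p (- x) \<le> norm (- x)" using p unfolding sublin_def by blast
    finally show ?thesis by simp
  qed
  have bdd: "bdd_below ((\<lambda>t. ?r t x) ` {0..})" for x
    using lower by (auto intro!: bdd_belowI[of _ "- norm x"])
  have r0: "?q x \<le> p x" for x
    using cINF_lower[OF bdd, of 0 x] by simp
  show "?q x \<le> p x" for x by (rule r0)
  show "?q (- y) \<le> - p y"
    using cINF_lower[OF bdd, of 1 "- y"] p0 by simp
  have add: "?q (u + v) \<le> ?q u + ?q v" for u v
  proof -
    have 1: "?q (u + v) \<le> ?r s u + ?r t v" if "s \<ge> 0" "t \<ge> 0" for s t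
    proof -
      have "?q (u + v) \<le> ?r (s + t) (u + v)"
        using that by (intro cINF_lower[OF bdd]) auto
      moreover have "p (u + v + (s + t) *\<^sub>R y) \<le> p (u + s *\<^sub>R y) + p (v + t *\<^sub>R y)"
        using sub[of "u + s *\<^sub>R y" "v + t *\<^sub>R y"] by (simp add: algebra_simps)
      ultimately show ?thesis by (simp add: algebra_simps)
    qed
    have "?q (u + v) - ?r s u \<le> ?q v" if "s \<ge> 0" for s
    proof (rule cINF_greatest)
      fix t :: real assume "t \<in> {0..}"
      then show "?q (u + v) - ?r s u \<le> ?r t v" using 1[OF that, of t] by simp
    qed simp
    then have 2: "?q (u + v) - ?q v \<le> ?r s u" if "s \<ge> 0" for s
      using that by (simp add: algebra_simps)
    have "?q (u + v) - ?q v \<le> ?q u"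
      by (rule cINF_greatest) (use 2 in auto)
    then show ?thesis by simp
  qed
  have le: "c * ?q x \<le> ?q (c *\<^sub>R x)" if c: "c > 0" for c x
  proof (rule cINF_greatest)
    fix t :: real assume t: "t \<in> {0..}"
    have "?q x \<le> ?r (t / c) x"
      using t c by (intro cINF_lower[OF bdd]) auto
    then have "c * ?q x \<le> c * ?r (t / c) x" using c by simp
    also have "\<dots> = ?r t (c *\<^sub>R x)"
      using hom[OF c, of "x + (t / c) *\<^sub>R y"] c by (simp add: algebra_simps)
    finally show "c * ?q x \<le> ?r t (c *\<^sub>R x)" .
  qed simp
  have hom_q: "?q (c *\<^sub>R x) = c * ?q x" if c: "c > 0" for c x
  proof (rule antisym[OF _ le[OF c]])
    have "inverse c * ?q (c *\<^sub>R x) \<le> ?q (inverse c *\<^sub>R c *\<^sub>R x)"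
      using c by (intro le) auto
    also have "inverse c *\<^sub>R c *\<^sub>R x = x" using c by simp
    finally show "?q (c *\<^sub>R x) \<le> c * ?q x"
      using c by (simp add: field_simps)
  qed
  have "?q x \<le> norm x" for x
    using r0[of x] p unfolding sublin_def by (meson order_trans)
  with add hom_q show "sublin ?q"
    unfolding sublin_def by blast
qed

lemma ex_norming_functional:
  fixes z :: "'a::real_normed_vector"
  obtains \<phi> :: "'a \<Rightarrow>\<^sub>L real" where "norm \<phi> \<le> 1" "\<phi> z = norm z"
proof -
  have "sublin (norm :: 'a \<Rightarrow> real)"
    by (simp add: sublin_def norm_triangle_ineq)
  from sublin_reduce[OF this, of z]
  obtain q where q: "sublin q" "q (- z) \<le> - norm z" by blast
  let ?A = "{p. sublin p \<and> (\<forall>x. p x \<le> q x)}"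
  let ?P = "\<lambda>p p'. \<forall>x. p' x \<le> p (x::'a)"
  have "\<exists>m\<in>?A. \<forall>a\<in>?A. ?P m a \<longrightarrow> a = m"
  proof (rule predicate_Zorn)
    show "partial_order_on ?A (relation_of ?P ?A)"
      by (rule partial_order_on_relation_ofI) (auto intro: order_trans intro!: antisym ext)
    fix C assume C: "C \<in> Chains (relation_of ?P ?A)"
    have CA: "C \<subseteq> ?A"
      using C unfolding Chains_def relation_of_def by auto
    have chain: "?P i j \<or> ?P j i" if "i \<in> C" "j \<in> C" for i j
      using C that unfolding Chains_def relation_of_def by blast
    show "\<exists>u\<in>?A. \<forall>a\<in>C. ?P a u"
    proof (cases "C = {}")
      case True
      with q show ?thesis by auto
    next
      case False
      have bdd: "bdd_below ((\<lambda>p. p x) ` C)" for x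
        using sublin_lower CA by (auto intro!: bdd_belowI[of _ "- norm x"])
      have "sublin (\<lambda>x. INF p\<in>C. p x)"
      proof (rule sublin_INF[OF False])
        show "sublin p" if "p \<in> C" for p
          using CA that by auto
        fix i j x y assume ij: "i \<in> C" "j \<in> C"
        have "i (x + y) \<le> i x + i y" "j (x + y) \<le> j x + j y"
          using ij CA by (auto simp: sublin_def)
        then show "\<exists>k\<in>C. k (x + y) \<le> i x + j y"
          using chain[OF ij] ij by (smt (verit))
      qed
      moreover have le: "(INF p\<in>C. p x) \<le> a x" if "a \<in> C" for a x
        by (rule cINF_lower[OF bdd that])
      moreover have "(INF p\<in>C. p x) \<le> q x" for x
      proof -
        obtain a where "a \<in> C" using False by auto
        with le[OF this, of x] CA show ?thesis by (auto intro: order_trans)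
      qed
      ultimately show ?thesis
        by (intro bexI[of _ "\<lambda>x. INF p\<in>C. p x"]) auto
    qed
  qed
  then obtain p where p: "sublin p" "\<And>x. p x \<le> q x"
    and min: "\<And>a. sublin a \<Longrightarrow> (\<And>x. a x \<le> q x) \<Longrightarrow> (\<And>x. a x \<le> p x) \<Longrightarrow> a = p"
    by blast
  have neg: "p (- y) \<le> - p y" for y
  proof -
    obtain r where r: "sublin r" "\<And>x. r x \<le> p x" "r (- y) \<le> - p y"
      using sublin_reduce[OF p(1), of y] by blast
    then have "r = p"
      using p(2) by (intro min) (auto intro: order_trans)
    with r show ?thesis by simp
  qed
  have sub: "p (u + v) \<le> p u + p v" for u v
    using p(1) by (simp add: sublin_def)
  have hom: "p (c *\<^sub>R u) = c * p u" if "c > 0" for c u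
    using p(1) that by (simp add: sublin_def)
  have p0: "p 0 = 0"
    using hom[of 2 0] by simp
  have neg_eq: "p (- y) = - p y" for y
    using neg[of y] sub[of y "- y"] p0 by simp
  have add_eq: "p (u + v) = p u + p v" for u v
    using sub[of u v] sub[of "- u" "- v"] neg_eq[of u] neg_eq[of v] neg_eq[of "u + v"] by simp
  have hom_eq: "p (c *\<^sub>R u) = c *\<^sub>R p u" for c u
  proof -
    consider "c > 0" | "c = 0" | "c < 0" by linarith
    then show ?thesis
    proof cases
      case 3
      then have "p (- (c *\<^sub>R u)) = - c * p u" using hom[of "- c" u] by simp
      then show ?thesis using neg_eq[of "c *\<^sub>R u"] by simp
    qed (use hom p0 in auto)
  qed
  have bound: "norm (p x) \<le> norm x * 1" for x
  proof -
    have "p x \<le> norm x" using p(1) unfolding sublin_def by blast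
    moreover have "- norm x \<le> p x" by (rule sublin_lower[OF p(1)])
    ultimately show ?thesis by simp
  qed
  have bl: "bounded_linear p"
    by (rule bounded_linear_intro[OF add_eq hom_eq bound])
  have "norm (Blinfun p) \<le> 1"
    by (rule norm_blinfun_bound) (use bl bound in \<open>auto simp: bounded_linear_Blinfun_apply\<close>)
  moreover have "p z = norm z"
  proof (rule antisym)
    show "p z \<le> norm z" using p(1) unfolding sublin_def by blast
    show "norm z \<le> p z" using p(2)[of "- z"] q(2) neg_eq[of z] by simp
  qed
  ultimately show ?thesis
    using that[of "Blinfun p"] bl by (simp add: bounded_linear_Blinfun_apply)
qed

lemma Hausdorff_weak_topology: "Hausdorff_space (weak_topology :: 'a::real_normed_vector topology)"
  unfolding Hausdorff_space_def
proof (intro allI impI, elim conjE)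
  fix x y :: 'a assume "x \<noteq> y"
  obtain \<phi> :: "'a \<Rightarrow>\<^sub>L real" where \<phi>: "\<phi> (x - y) = norm (x - y)"
    using ex_norming_functional by metis
  then have "\<phi> x \<noteq> \<phi> y"
    using \<open>x \<noteq> y\<close> by (auto simp: blinfun.diff_right)
  then obtain U V where UV: "open U" "open V" "\<phi> x \<in> U" "\<phi> y \<in> V" "U \<inter> V = {}"
    using hausdorff[of "\<phi> x" "\<phi> y"] by blast
  have "openin weak_topology (\<phi> -` W)" if "open W" for W
    using openin_continuous_map_preimage[OF continuous_map_weak_functional[of \<phi>], of W] that
    by (simp add: vimage_def)
  with UV show "\<exists>U V. openin weak_topology U \<and> openin weak_topology V \<and> x \<in> U \<and> y \<in> V \<and> disjnt U V"
    by (intro exI[of _ "\<phi> -` U"] exI[of _ "\<phi> -` V"]) (auto simp: disjnt_def)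
qed


subsection \<open>The condition for an arbitrary target space\<close>

lemma weakly_compact_operator_compose:
  fixes S :: "'a::real_normed_vector \<Rightarrow>\<^sub>L 'b::real_normed_vector"
    and J :: "'b \<Rightarrow>\<^sub>L 'c::real_normed_vector"
  assumes "weakly_compact_operator S"
  shows "weakly_compact_operator (J o\<^sub>L S)"
  unfolding weakly_compact_operator_def
proof (intro allI impI)
  fix A :: "'a set" assume "bounded A"
  let ?K = "weak_topology closure_of (S ` A)"
  have "weakly_compact ?K"
    using assms \<open>bounded A\<close> by (simp add: weakly_compact_operator_def)
  then have K: "weakly_compact (J ` ?K)"
    by (rule image_compactin[OF _ continuous_map_weak_blinfun])
  then have "closedin weak_topology (J ` ?K)"
    by (rule compactin_imp_closedin[OF Hausdorff_weak_topology])
  moreover have "(J o\<^sub>L S) ` A \<subseteq> J ` ?K"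
    using closure_of_subset[of "S ` A" weak_topology] by auto
  ultimately have "weak_topology closure_of ((J o\<^sub>L S) ` A) \<subseteq> J ` ?K"
    by (intro closure_of_minimal)
  then show "weakly_compact (weak_topology closure_of ((J o\<^sub>L S) ` A))"
    by (rule closed_compactin[OF K]) simp
qed

theorem dunford_pettis_imp_into:
  assumes dp: "dunford_pettis TYPE('a::banach)"
  shows "dunford_pettis_into TYPE('a) TYPE('z::banach)"
  unfolding dunford_pettis_into_def
proof (intro allI impI)
  fix S :: "'a \<Rightarrow>\<^sub>L 'z" and W :: "'a set"
  assume S: "weakly_compact_operator S" and W: "weakly_compact W"
  have "\<forall>x::'a. \<exists>\<phi>::'z \<Rightarrow>\<^sub>L real. norm \<phi> \<le> 1 \<and> blinfun_apply \<phi> (S x) = norm (S x)"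
    using ex_norming_functional by metis
  then obtain \<phi> :: "'a \<Rightarrow> 'z \<Rightarrow>\<^sub>L real"
    where \<phi>: "\<And>x. norm (\<phi> x) \<le> 1" "\<And>x. blinfun_apply (\<phi> x) (S x) = norm (S x)"
    by metis
  have \<phi>_le: "norm (blinfun_apply (\<phi> x) z) \<le> norm z" for x z
  proof -
    have "norm (blinfun_apply (\<phi> x) z) \<le> norm (\<phi> x) * norm z" by (rule norm_blinfun)
    also have "\<dots> \<le> 1 * norm z" by (intro mult_right_mono \<phi>) auto
    finally show ?thesis by simp
  qed
  define j :: "'z \<Rightarrow> 'a discrete \<Rightarrow>\<^sub>C real" where "j z = Bcontfun (\<lambda>d. blinfun_apply (\<phi> (of_discrete d)) z)" for z
  have j: "apply_bcontfun (j z) d = blinfun_apply (\<phi> (of_discrete d)) z" for z d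
  proof -
    have "continuous_on UNIV (\<lambda>d. blinfun_apply (\<phi> (of_discrete d)) z)"
      by (auto simp: continuous_on_open_vimage open_discrete)
    moreover have "bounded (range (\<lambda>d. blinfun_apply (\<phi> (of_discrete d)) z))"
      using \<phi>_le[of _ z] by (auto simp: bounded_iff)
    ultimately show ?thesis
      by (simp add: j_def Bcontfun_inverse bcontfun_def)
  qed
  have bl: "bounded_linear j"
  proof (rule bounded_linear_intro)
    show "j (x + y) = j x + j y" for x y
      by (rule bcontfun_eqI) (simp add: j blinfun.add_right)
    show "j (r *\<^sub>R x) = r *\<^sub>R j x" for r x
      by (rule bcontfun_eqI) (simp add: j blinfun.scaleR_right)
    show "norm (j x) \<le> norm x * 1" for x
    proof -
      have "norm (j x) \<le> norm x"
        by (rule norm_bound) (simp only: j \<phi>_le)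
      then show ?thesis by simp
    qed
  qed
  define J where "J = Blinfun j"
  have J: "blinfun_apply J = j"
    by (simp add: J_def bounded_linear_Blinfun_apply[OF bl])
  have iso: "norm (S x) \<le> norm (J (S x))" for x
    using norm_bounded[of "j (S x)" "discrete x"]
    unfolding J j by (simp add: discrete_inverse \<phi>(2))
  have "compact ((J o\<^sub>L S) ` W)"
    using dp weakly_compact_operator_compose[OF S, of J] W
    unfolding dunford_pettis_def dunford_pettis_into_def by blast
  then have sc: "seq_compact ((J o\<^sub>L S) ` W)"
    by (simp add: compact_eq_seq_compact_metric)
  have "seq_compact (S ` W)"
    unfolding seq_compact_def
  proof (intro allI impI)
    fix f :: "nat \<Rightarrow> 'z" assume "\<forall>n. f n \<in> S ` W"
    then have "\<forall>n. \<exists>x. x \<in> W \<and> f n = S x"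
      by blast
    then obtain w where "\<forall>n. w n \<in> W \<and> f n = S (w n)"
      by (rule choice[THEN exE])
    then have w: "w n \<in> W" "f n = S (w n)" for n
      by auto
    define g where "g n = blinfun_apply (J o\<^sub>L S) (w n)" for n
    have "\<forall>n. g n \<in> (J o\<^sub>L S) ` W" using w by (auto simp: g_def)
    then obtain l r where lr: "l \<in> (J o\<^sub>L S) ` W" "strict_mono (r :: nat \<Rightarrow> nat)" "(g \<circ> r) \<longlonglongrightarrow> l"
      using sc unfolding seq_compact_def by blast
    then obtain x where x: "x \<in> W" "l = J (S x)" by auto
    have "(\<lambda>n. J (S (w (r n))) - J (S x)) \<longlonglongrightarrow> 0"
      using lr(3) x by (simp add: o_def g_def LIM_zero_iff)
    then have lim: "(\<lambda>n. norm (J (S (w (r n))) - J (S x))) \<longlonglongrightarrow> 0"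
      by (rule tendsto_norm_zero)
    have le: "norm (S (w (r n)) - S x) \<le> norm (J (S (w (r n))) - J (S x))" for n
      using iso[of "w (r n) - x"] by (simp add: blinfun.diff_right)
    have "(\<lambda>n. S (w (r n)) - S x) \<longlonglongrightarrow> 0"
      by (rule Lim_null_comparison[OF always_eventually lim]) (rule allI, rule le)
    then have "(f \<circ> r) \<longlonglongrightarrow> S x"
      by (simp add: o_def w LIM_zero_iff)
    with lr x show "\<exists>l\<in>S ` W. \<exists>r. strict_mono r \<and> (f \<circ> r) \<longlonglongrightarrow> l"
      by blast
  qed
  then show "compact (S ` W)"
    by (simp add: compact_eq_seq_compact_metric)
qed


section \<open>The Banach space of compact operators\<close>

definition compact_operator :: "('a::real_normed_vector \<Rightarrow>\<^sub>L 'b::real_normed_vector) \<Rightarrow> bool"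
  where "compact_operator f \<longleftrightarrow> (\<forall>A. bounded A \<longrightarrow> compact (closure (blinfun_apply f ` A)))"

lemma compact_closure_subset:
  fixes A :: "'a::metric_space set"
  assumes "compact K" "A \<subseteq> K"
  shows "compact (closure A)"
proof -
  have "closure A \<subseteq> K"
    using assms by (intro closure_minimal compact_imp_closed)
  then show ?thesis
    using compact_Int_closed[OF assms(1), of "closure A"] by (simp add: inf.absorb2)
qed

lemma compact_operator_zero: "compact_operator 0"
  unfolding compact_operator_def
  by (auto intro!: compact_closure_subset[of "{0}"])

lemma compact_operator_add:
  assumes "compact_operator f" "compact_operator g"
  shows "compact_operator (f + g)"
  unfolding compact_operator_def
proof (intro allI impI)
  fix A :: "'a set" assume A: "bounded A"
  let ?F = "closure (f ` A)" and ?G = "closure (g ` A)"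
  have "compact {x + y | x y. x \<in> ?F \<and> y \<in> ?G}"
    using assms A by (intro compact_sums) (auto simp: compact_operator_def)
  moreover have "(f + g) ` A \<subseteq> {x + y | x y. x \<in> ?F \<and> y \<in> ?G}"
    using closure_subset[of "f ` A"] closure_subset[of "g ` A"]
    by (fastforce simp: blinfun.add_left)
  ultimately show "compact (closure ((f + g) ` A))"
    by (rule compact_closure_subset)
qed

lemma compact_operator_scaleR:
  assumes "compact_operator f"
  shows "compact_operator (c *\<^sub>R f)"
  unfolding compact_operator_def
proof (intro allI impI)
  fix A :: "'a set" assume A: "bounded A"
  have "compact ((*\<^sub>R) c ` closure (f ` A))"
    using assms A by (intro compact_scaling) (auto simp: compact_operator_def)
  moreover have "(c *\<^sub>R f) ` A \<subseteq> (*\<^sub>R) c ` closure (f ` A)"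
    using closure_subset[of "f ` A"] by (auto simp: blinfun.scaleR_left)
  ultimately show "compact (closure ((c *\<^sub>R f) ` A))"
    by (rule compact_closure_subset)
qed

lemma compact_operator_uminus: "compact_operator f \<Longrightarrow> compact_operator (- f)"
  using compact_operator_scaleR[of f "- 1"] by simp

lemma compact_operator_minus:
  "compact_operator f \<Longrightarrow> compact_operator g \<Longrightarrow> compact_operator (f - g)"
  using compact_operator_add[of f "- g"] compact_operator_uminus[of g] by simp

lemma compact_operator_limit:
  fixes f :: "'a::real_normed_vector \<Rightarrow>\<^sub>L 'b::banach"
  assumes F: "\<And>n. compact_operator (F n)" and lim: "F \<longlonglongrightarrow> f"
  shows "compact_operator f"
  unfolding compact_operator_def
proof (intro allI impI)
  fix A :: "'a set" assume A: "bounded A"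
  obtain M where M: "M > 0" "\<And>x. x \<in> A \<Longrightarrow> norm x \<le> M"
    using A by (auto simp: bounded_pos)
  have "\<exists>k. finite k \<and> closure (f ` A) \<subseteq> (\<Union>x\<in>k. ball x e)" if "e > 0" for e
  proof -
    have "e / (4 * M) > 0" using M(1) \<open>e > 0\<close> by simp
    from LIMSEQ_D[OF lim this] obtain n where n: "norm (F n - f) < e / (4 * M)" by blast
    have "compact (closure (F n ` A))"
      using F A by (auto simp: compact_operator_def)
    then obtain k where k: "finite k" "closure (F n ` A) \<subseteq> (\<Union>x\<in>k. ball x (e / 4))"
      using \<open>e > 0\<close> by (metis compact_eq_totally_bounded zero_less_divide_iff zero_less_numeral)
    have "f ` A \<subseteq> (\<Union>x\<in>k. cball x (e / 2))"
    proof
      fix y assume "y \<in> f ` A"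
      then obtain a where a: "a \<in> A" "y = f a" by auto
      then have "F n a \<in> (\<Union>x\<in>k. ball x (e / 4))"
        using k(2) closure_subset by fast
      then obtain x where x: "x \<in> k" "dist x (F n a) < e / 4" by auto
      have "dist (F n a) (f a) = norm ((F n - f) a)"
        by (simp add: dist_norm blinfun.diff_left)
      also have "\<dots> \<le> norm (F n - f) * norm a" by (rule norm_blinfun)
      also have "\<dots> \<le> e / (4 * M) * M"
        using n M a \<open>e > 0\<close> by (intro mult_mono) auto
      also have "\<dots> = e / 4" using M(1) by simp
      finally have "dist x y \<le> e / 2"
        using x(2) dist_triangle[of x y "F n a"] a by simp
      with x show "y \<in> (\<Union>x\<in>k. cball x (e / 2))" by auto
    qed
    moreover have "closed (\<Union>x\<in>k. cball x (e / 2))"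
      using k(1) by auto
    ultimately have "closure (f ` A) \<subseteq> (\<Union>x\<in>k. cball x (e / 2))"
      by (rule closure_minimal)
    also have "\<dots> \<subseteq> (\<Union>x\<in>k. ball x e)"
      using \<open>e > 0\<close> by (force simp: subset_iff)
    finally show ?thesis using k(1) by blast
  qed
  then show "compact (closure (f ` A))"
    by (auto simp: compact_eq_totally_bounded complete_eq_closed)
qed

typedef (overloaded) ('a, 'b) compact_op (\<open>(_ \<Rightarrow>\<^sub>K /_)\<close> [22, 21] 21) =
  "{f :: 'a::real_normed_vector \<Rightarrow>\<^sub>L 'b::real_normed_vector. compact_operator f}"
  morphisms blinfun_of_compact_op Compact_op
  using compact_operator_zero by blast

setup_lifting type_definition_compact_op

instantiation compact_op :: (real_normed_vector, real_normed_vector) real_normed_vector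
begin

lift_definition norm_compact_op :: "'a \<Rightarrow>\<^sub>K 'b \<Rightarrow> real" is norm .

lift_definition zero_compact_op :: "'a \<Rightarrow>\<^sub>K 'b" is 0
  by (rule compact_operator_zero)

lift_definition plus_compact_op :: "'a \<Rightarrow>\<^sub>K 'b \<Rightarrow> 'a \<Rightarrow>\<^sub>K 'b \<Rightarrow> 'a \<Rightarrow>\<^sub>K 'b" is "(+)"
  by (rule compact_operator_add)

lift_definition minus_compact_op :: "'a \<Rightarrow>\<^sub>K 'b \<Rightarrow> 'a \<Rightarrow>\<^sub>K 'b \<Rightarrow> 'a \<Rightarrow>\<^sub>K 'b" is "(-)"
  by (rule compact_operator_minus)

lift_definition uminus_compact_op :: "'a \<Rightarrow>\<^sub>K 'b \<Rightarrow> 'a \<Rightarrow>\<^sub>K 'b" is uminus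
  by (rule compact_operator_uminus)

lift_definition scaleR_compact_op :: "real \<Rightarrow> 'a \<Rightarrow>\<^sub>K 'b \<Rightarrow> 'a \<Rightarrow>\<^sub>K 'b" is "(*\<^sub>R)"
  by (rule compact_operator_scaleR)

definition dist_compact_op :: "'a \<Rightarrow>\<^sub>K 'b \<Rightarrow> 'a \<Rightarrow>\<^sub>K 'b \<Rightarrow> real"
  where "dist_compact_op X Y = norm (X - Y)"

definition uniformity_compact_op :: "(('a \<Rightarrow>\<^sub>K 'b) \<times> ('a \<Rightarrow>\<^sub>K 'b)) filter"
  where "uniformity_compact_op = (INF e\<in>{0 <..}. principal {(x, y). dist x y < e})"

definition open_compact_op :: "('a \<Rightarrow>\<^sub>K 'b) set \<Rightarrow> bool"
  where "open_compact_op S = (\<forall>x\<in>S. \<forall>\<^sub>F (x', y) in uniformity. x' = x \<longrightarrow> y \<in> S)"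

definition sgn_compact_op :: "'a \<Rightarrow>\<^sub>K 'b \<Rightarrow> 'a \<Rightarrow>\<^sub>K 'b"
  where "sgn_compact_op X = inverse (norm X) *\<^sub>R X"

instance
  apply standard
  unfolding dist_compact_op_def open_compact_op_def sgn_compact_op_def uniformity_compact_op_def
  apply (rule refl | (transfer, force simp: algebra_simps norm_triangle_ineq))+
  done

end

instance compact_op :: (real_normed_vector, banach) banach
proof
  fix X :: "nat \<Rightarrow> 'a \<Rightarrow>\<^sub>K 'b"
  assume "Cauchy X"
  have dist: "dist Y Z = dist (blinfun_of_compact_op Y) (blinfun_of_compact_op Z)"
    for Y Z :: "'a \<Rightarrow>\<^sub>K 'b"
    by (simp add: dist_norm norm_compact_op.rep_eq minus_compact_op.rep_eq)
  from \<open>Cauchy X\<close> have "Cauchy (\<lambda>n. blinfun_of_compact_op (X n))"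
    by (simp add: Cauchy_def dist)
  then obtain f where f: "(\<lambda>n. blinfun_of_compact_op (X n)) \<longlonglongrightarrow> f"
    by (auto simp: Cauchy_convergent_iff convergent_def)
  have "compact_operator f"
    by (rule compact_operator_limit[OF _ f]) (use blinfun_of_compact_op in auto)
  then have "X \<longlonglongrightarrow> Compact_op f"
    using f by (simp add: lim_sequentially dist Compact_op_inverse)
  then show "convergent X"
    by (auto simp: convergent_def)
qed

definition compact_op_apply :: "('a::real_normed_vector \<Rightarrow>\<^sub>K 'b::real_normed_vector) \<Rightarrow> 'a \<Rightarrow> 'b"
  where "compact_op_apply X y = blinfun_apply (blinfun_of_compact_op X) y"

end

theory Submission
  imports Defs
begin

text \<open>
  Everything turns on the duality pairing. Say that the pairing of \<open>E\<close> is sequentially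
  continuous if \<open>\<phi>\<^sub>n(x\<^sub>n)\<close> tends to \<open>\<phi>(x)\<close> whenever \<open>\<phi>\<^sub>n\<close> tends weakly to
  \<open>\<phi>\<close> in the dual and \<open>x\<^sub>n\<close> tends weakly to \<open>x\<close> in \<open>E\<close>. For a target space that contains a
  vector \<open>e \<noteq> 0\<close>, weak sequential continuity of \<open>(X, y) \<mapsto> X y\<close> on compact operators is the same
  property: composing with a functional \<open>\<psi>\<close> of the target sends a weakly convergent sequence of
  operators to a weakly convergent sequence in the dual, and conversely the rank one operators
  \<open>x \<mapsto> \<phi>(x) e\<close> embed the dual into the compact operators
  (\<open>compact_op_apply_weakly_seq_continuous_iff\<close>).

  The Dunford--Pettis property implies continuity of the pairing because a weakly null sequence
  \<open>\<phi>\<^sub>n\<close> in the dual defines an operator \<open>x \<mapsto> (\<phi>\<^sub>n(x))\<^sub>n\<close> into the null sequences which is weakly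
  compact: it extends to the bidual, whose balls are compact by Banach--Alaoglu
  (\<open>weakly_null_sequence_operator\<close>). By bilinearity it is enough to treat weakly null sequences
  \<open>x\<^sub>n\<close>. The operator maps a weakly null sequence \<open>x\<^sub>n\<close> into a norm
  compact set, hence to a norm null sequence, and \<open>\<phi>\<^sub>n(x\<^sub>n)\<close> is one of the coordinates of the image.

  Conversely, let \<open>S\<close> be weakly compact, let \<open>x\<^sub>n\<close> tend weakly to \<open>x\<close>, and let \<open>\<psi>\<^sub>n\<close> be a
  functional of norm at most one that norms \<open>S(x\<^sub>n - x)\<close>. The norm of \<open>S(x\<^sub>n - x)\<close> is the pairing of \<open>\<psi>\<^sub>n \<circ> S\<close> with \<open>x\<^sub>n - x\<close>. By
  Gantmacher's theorem the functionals \<open>\<psi>\<^sub>n \<circ> S\<close> lie in a weakly compact subset of the dual, so by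
  the Eberlein--Smulian theorem a subsequence of them converges weakly, and continuity of the pairing
  gives norm convergence along that subsequence.

  The minimum is attained by the direct method: the Eberlein--Smulian theorem supplies weakly
  convergent minimising sequences in \<open>C\<close> and \<open>D\<close>, the arguments of the three norms converge weakly by
  the first part, norms are weakly lower semicontinuous, and \<open>f\<close> is increasing and continuous.
\<close>

section \<open>Separation of points from closed subspaces\<close>

text \<open>
  Zorn's lemma applies because the pointwise infimum of a chain of sublinear functionals is sublinear.
\<close>

lemma minimal_sublin_exists:
  assumes "sublin q"
  obtains m where "sublin m" "m \<le> q" "\<And>a. sublin a \<Longrightarrow> a \<le> m \<Longrightarrow> a = m"
proof -
  let ?A = "{p. sublin p \<and> p \<le> q}"
  have "\<exists>m\<in>?A. \<forall>a\<in>?A. m \<ge> a \<longrightarrow> a = m"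
  proof (rule predicate_Zorn)
    show "partial_order_on ?A (relation_of (\<ge>) ?A)"
      by (rule partial_order_on_relation_ofI) auto
    fix C assume C: "C \<in> Chains (relation_of (\<ge>) ?A)"
    have CA: "C \<subseteq> ?A"
      using C unfolding Chains_def relation_of_def by auto
    have chain: "i \<ge> j \<or> j \<ge> i" if "i \<in> C" "j \<in> C" for i j
      using C that unfolding Chains_def relation_of_def by blast
    show "\<exists>u\<in>?A. \<forall>a\<in>C. a \<ge> u"
    proof (cases "C = {}")
      case True
      with assms show ?thesis by auto
    next
      case False
      have bdd: "bdd_below ((\<lambda>p. p x) ` C)" for x
        using sublin_lower CA by (auto intro!: bdd_belowI[of _ "- norm x"])
      have "sublin (\<lambda>x. INF p\<in>C. p x)"
      proof (rule sublin_INF[OF False])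
        show "sublin p" if "p \<in> C" for p
          using CA that by auto
        fix i j x y assume ij: "i \<in> C" "j \<in> C"
        then have sub: "i (x + y) \<le> i x + i y" "j (x + y) \<le> j x + j y"
          using CA by (auto simp: sublin_def)
        show "\<exists>k\<in>C. k (x + y) \<le> i x + j y"
        proof (cases "i \<le> j")
          case True
          then show ?thesis
            using sub(1) ij(1) le_funD[OF True, of y] by (intro bexI[of _ i]) auto
        next
          case False
          then have "j x \<le> i x"
            using chain[OF ij] by (auto simp: le_fun_def)
          then show ?thesis
            using sub(2) ij(2) by (intro bexI[of _ j]) auto
        qed
      qed
      moreover have le: "(\<lambda>x. INF p\<in>C. p x) \<le> a" if "a \<in> C" for a
        by (rule le_funI) (rule cINF_lower[OF bdd that])
      moreover obtain a where "a \<in> C" using False by auto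
      ultimately show ?thesis
        using CA by (intro bexI[of _ "\<lambda>x. INF p\<in>C. p x"]) (auto intro: order_trans)
    qed
  qed
  then show ?thesis
    using that by (auto intro: order_trans)
qed

text \<open>
  For every \<open>y\<close>, lemma \<open>sublin_reduce\<close> lowers \<open>m\<close> to a sublinear functional whose value at \<open>- y\<close>
  is at most \<open>- m y\<close>. By minimality this changes nothing, so \<open>m\<close> is odd, and an odd sublinear
  functional is linear.
\<close>

lemma minimal_sublin_linear:
  assumes m: "sublin m" and min: "\<And>a. sublin a \<Longrightarrow> a \<le> m \<Longrightarrow> a = m"
  obtains \<phi> :: "'a::real_normed_vector \<Rightarrow>\<^sub>L real" where "m = blinfun_apply \<phi>"
proof -
  have neg: "m (- y) \<le> - m y" for y
  proof -
    obtain r where r: "sublin r" "\<And>x. r x \<le> m x" "r (- y) \<le> - m y"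
      using sublin_reduce[OF m, of y] by blast
    then have "r = m" by (intro min) (auto intro: le_funI)
    with r show ?thesis by simp
  qed
  have sub: "m (u + v) \<le> m u + m v" for u v
    using m by (simp add: sublin_def)
  have hom: "m (c *\<^sub>R u) = c * m u" if "c > 0" for c u
    using m that by (simp add: sublin_def)
  have m0: "m 0 = 0"
    using hom[of 2 0] by simp
  have neg_eq: "m (- y) = - m y" for y
    using neg[of y] sub[of y "- y"] m0 by simp
  have add_eq: "m (u + v) = m u + m v" for u v
    using sub[of u v] sub[of "- u" "- v"] neg_eq[of u] neg_eq[of v] neg_eq[of "u + v"] by simp
  have hom_eq: "m (c *\<^sub>R u) = c *\<^sub>R m u" for c u
    using hom[of c u] hom[of "- c" u] neg_eq[of "c *\<^sub>R u"] m0
    by (cases "c > 0"; cases "c = 0") auto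
  have "norm (m x) \<le> norm x * 1" for x
    using m sublin_lower[OF m, of x] unfolding sublin_def by (simp add: abs_le_iff minus_le_iff)
  then have "bounded_linear m"
    by (rule bounded_linear_intro[OF add_eq hom_eq])
  from that[of "Blinfun m"] this show ?thesis
    by (simp add: bounded_linear_Blinfun_apply)
qed

text \<open>
  Sublinear functionals are bounded by the norm, so the dominated functional is automatically
  continuous. Lowering \<open>p\<close> at \<open>- z\<close> before passing to a minimal element is what forces equality
  at \<open>z\<close>.
\<close>

lemma Hahn_Banach_sublin:
  fixes p :: "'a::real_normed_vector \<Rightarrow> real"
  assumes "sublin p"
  obtains \<phi> :: "'a \<Rightarrow>\<^sub>L real" where "\<And>x. \<phi> x \<le> p x" "\<phi> z = p z"
proof -
  obtain q where q: "sublin q" "\<And>x. q x \<le> p x" "q (- z) \<le> - p z"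
    using sublin_reduce[OF assms, of z] by blast
  obtain m where m: "sublin m" "m \<le> q" "\<And>a. sublin a \<Longrightarrow> a \<le> m \<Longrightarrow> a = m"
    by (rule minimal_sublin_exists[OF q(1)]) blast
  obtain \<phi> :: "'a \<Rightarrow>\<^sub>L real" where \<phi>: "m = blinfun_apply \<phi>"
    by (rule minimal_sublin_linear[OF m(1,3)]) auto
  have le: "\<phi> x \<le> q x" for x
    using m(2) \<phi> by (auto simp: le_fun_def)
  show ?thesis
  proof
    show le_p: "\<phi> x \<le> p x" for x
      using le q(2) by (rule order_trans)
    show "\<phi> z = p z"
      using le_p[of z] le[of "- z"] q(3) by (simp add: blinfun.minus_right)
  qed
qed

text \<open>
  The distance to \<open>Y\<close> is the seminorm of the quotient by \<open>Y\<close>; a functional that it dominates vanishes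
  on \<open>Y\<close>.
\<close>

lemma sublin_infdist_subspace:
  assumes Y: "subspace Y"
  shows "sublin (\<lambda>x. infdist x Y)"
proof -
  have ne: "Y \<noteq> {}" and 0: "0 \<in> Y"
    using subspace_0[OF Y] by auto
  have near: "\<exists>u\<in>Y. dist x u < infdist x Y + e" if "e > 0" for x e
    using cInf_lessD[of "dist x ` Y" "infdist x Y + e"] ne that by (auto simp: infdist_def)
  have add: "infdist (x + y) Y \<le> infdist x Y + infdist y Y" for x y
  proof (rule field_le_epsilon)
    fix e :: real assume "e > 0"
    obtain u where u: "u \<in> Y" "dist x u < infdist x Y + e / 2"
      using near[of "e / 2" x] \<open>e > 0\<close> by auto
    obtain v where v: "v \<in> Y" "dist y v < infdist y Y + e / 2"
      using near[of "e / 2" y] \<open>e > 0\<close> by auto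
    have "infdist (x + y) Y \<le> dist (x + y) (u + v)"
      using u v Y by (intro infdist_le subspace_add)
    also have "\<dots> \<le> dist x u + dist y v"
      by (rule dist_triangle_add)
    finally show "infdist (x + y) Y \<le> infdist x Y + infdist y Y + e"
      using u v by simp
  qed
  have le: "infdist (c *\<^sub>R x) Y \<le> c * infdist x Y" if "c > 0" for c x
  proof (rule field_le_epsilon)
    fix e :: real assume "e > 0"
    then have "e / c > 0" using that by simp
    obtain u where u: "u \<in> Y" "dist x u < infdist x Y + e / c"
      using near[OF \<open>e / c > 0\<close>, of x] by auto
    have "infdist (c *\<^sub>R x) Y \<le> dist (c *\<^sub>R x) (c *\<^sub>R u)"
      using u Y by (intro infdist_le subspace_scale)
    also have "\<dots> = c * dist x u"
      using that by (simp add: dist_norm flip: scaleR_diff_right)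
    also have "\<dots> \<le> c * (infdist x Y + e / c)"
      using u that by (intro mult_left_mono) auto
    finally show "infdist (c *\<^sub>R x) Y \<le> c * infdist x Y + e"
      using that by (simp add: distrib_left)
  qed
  have hom: "infdist (c *\<^sub>R x) Y = c * infdist x Y" if "c > 0" for c x
  proof (rule antisym[OF le[OF that]])
    have "infdist x Y = infdist (inverse c *\<^sub>R c *\<^sub>R x) Y"
      using that by simp
    also have "\<dots> \<le> inverse c * infdist (c *\<^sub>R x) Y"
      using that by (intro le) auto
    finally show "c * infdist x Y \<le> infdist (c *\<^sub>R x) Y"
      using that by (simp add: field_simps)
  qed
  have "infdist x Y \<le> norm x" for x
    using infdist_le[OF 0, of x] by simp
  with add hom show ?thesis
    unfolding sublin_def by blast
qed

lemma separate_point_closed_subspace: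
  fixes z :: "'a::real_normed_vector"
  assumes Y: "subspace Y" "closed Y" and z: "z \<notin> Y"
  obtains \<phi> :: "'a \<Rightarrow>\<^sub>L real" where "\<And>y. y \<in> Y \<Longrightarrow> \<phi> y = 0" "\<phi> z \<noteq> 0"
proof -
  obtain \<phi> :: "'a \<Rightarrow>\<^sub>L real" where \<phi>: "\<And>x. \<phi> x \<le> infdist x Y" "\<phi> z = infdist z Y"
    by (rule Hahn_Banach_sublin[OF sublin_infdist_subspace[OF Y(1)], where z = z]) blast
  show ?thesis
  proof
    show "\<phi> y = 0" if "y \<in> Y" for y
      using \<phi>(1)[of y] \<phi>(1)[of "- y"] that subspace_neg[OF Y(1) that]
      by (simp add: blinfun.minus_right)
    show "\<phi> z \<noteq> 0"
      using \<phi>(2) z Y in_closed_iff_infdist_zero[of Y z] subspace_0[OF Y(1)] by auto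
  qed
qed

lemma closedin_weak_functional:
  fixes \<phi> :: "'a::real_normed_vector \<Rightarrow>\<^sub>L real"
  shows "closedin weak_topology {x. \<phi> x = c}"
  using closedin_continuous_map_preimage[OF continuous_map_weak_functional[of \<phi>], of "{c}"]
  by simp

lemma closedin_weak_closed_subspace:
  fixes Y :: "'a::real_normed_vector set"
  assumes Y: "subspace Y" "closed Y"
  shows "closedin weak_topology Y"
proof -
  let ?K = "{\<phi> :: 'a \<Rightarrow>\<^sub>L real. \<forall>y\<in>Y. \<phi> y = 0}"
  have "z \<in> Y" if "\<And>\<phi>. \<phi> \<in> ?K \<Longrightarrow> blinfun_apply \<phi> z = 0" for z
  proof (rule ccontr)
    assume "z \<notin> Y"
    then obtain \<phi> :: "'a \<Rightarrow>\<^sub>L real" where "\<And>y. y \<in> Y \<Longrightarrow> \<phi> y = 0" "\<phi> z \<noteq> 0"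
      by (rule separate_point_closed_subspace[OF Y]) auto
    with that show False by simp
  qed
  then have "Y = (\<Inter>\<phi>\<in>?K. {x. blinfun_apply \<phi> x = 0})"
    by auto
  moreover have "0 \<in> ?K"
    by simp
  then have "closedin weak_topology (\<Inter>\<phi>\<in>?K. {x. blinfun_apply \<phi> x = 0})"
    by (intro closedin_INT closedin_weak_functional) blast
  ultimately show ?thesis by simp
qed

section \<open>The Eberlein--Smulian theorem\<close>

text \<open>
  The coefficients are rational and the combinations are indexed by lists of pairs, a countable type,
  so that the range is a countable dense subset of the span. An index may occur several times, which
  turns addition into concatenation.
\<close>

definition rational_combination :: "(nat \<Rightarrow> 'a::real_vector) \<Rightarrow> (rat \<times> nat) list \<Rightarrow> 'a"
  where "rational_combination w c = (\<Sum>(q, i)\<leftarrow>c. of_rat q *\<^sub>R w i)"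

lemma rational_combination_append:
  "rational_combination w (c @ d) = rational_combination w c + rational_combination w d"
  by (simp add: rational_combination_def)

lemma rational_combination_scale:
  "rational_combination w (map (\<lambda>(q, i). (r * q, i)) c) = of_rat r *\<^sub>R rational_combination w c"
  unfolding rational_combination_def
  by (induction c) (auto simp: of_rat_mult scaleR_add_right)

text \<open>
  The combinations themselves admit only rational scalars; real scalars are reached by density of the
  rationals.
\<close>

lemma subspace_closure_rational_combinations:
  fixes w :: "nat \<Rightarrow> 'a::real_normed_vector"
  shows "subspace (closure (range (rational_combination w)))"
proof -
  let ?R = "range (rational_combination w)"
  let ?Y = "closure ?R"
  have 0: "0 \<in> ?Y"
    by (rule closure_subset[THEN subsetD], rule image_eqI[of _ _ "[]"])
       (auto simp: rational_combination_def)
  have add: "x + y \<in> ?Y" if "x \<in> ?Y" "y \<in> ?Y" for x y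
  proof -
    obtain a where a: "\<And>n. a n \<in> ?R" "a \<longlonglongrightarrow> x"
      using \<open>x \<in> ?Y\<close> unfolding closure_sequential by auto
    obtain b where b: "\<And>n. b n \<in> ?R" "b \<longlonglongrightarrow> y"
      using \<open>y \<in> ?Y\<close> unfolding closure_sequential by auto
    have "a n + b n \<in> ?R" for n
      using a(1)[of n] b(1)[of n] by (auto simp flip: rational_combination_append)
    with tendsto_add[OF a(2) b(2)] show ?thesis
      unfolding closure_sequential by (intro exI[of _ "\<lambda>n. a n + b n"]) auto
  qed
  have rat: "of_rat r *\<^sub>R x \<in> ?Y" if "x \<in> ?Y" for r x
  proof -
    have "(*\<^sub>R) (of_rat r) ` ?Y \<subseteq> closure ((*\<^sub>R) (of_rat r) ` ?R)"
      by (rule image_closure_subset) (auto intro!: continuous_intros closure_subset)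
    also have "\<dots> \<subseteq> ?Y"
      by (rule closure_mono) (auto simp flip: rational_combination_scale)
    finally show ?thesis using that by auto
  qed
  have scale: "c *\<^sub>R x \<in> ?Y" if "x \<in> ?Y" for c :: real and x
  proof -
    have "(\<lambda>c. c *\<^sub>R x) ` closure \<rat> \<subseteq> ?Y"
      by (rule image_closure_subset) (auto intro!: continuous_intros rat that elim!: Rats_cases)
    then show ?thesis
      by (auto simp: Rats_closure_real)
  qed
  show ?thesis
    by (rule subspaceI) (auto intro: 0 add scale)
qed

text \<open>
  \<open>Y\<close> is the closed span of the sequence and \<open>\<phi> k\<close> is a norming functional of the \<open>k\<close>-th element
  of a dense sequence \<open>d\<close> in \<open>Y\<close>. If all \<open>\<phi> k\<close> vanish at \<open>z\<close> and \<open>d k\<close> is close to \<open>z\<close>, then the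
  norm of \<open>d k\<close> is \<open>\<phi> k (d k - z)\<close>, so \<open>d k\<close> is small, and hence so is \<open>z\<close>.
\<close>

lemma countable_separating_functionals:
  fixes w :: "nat \<Rightarrow> 'a::real_normed_vector"
  obtains Y and \<phi> :: "nat \<Rightarrow> 'a \<Rightarrow>\<^sub>L real"
  where "subspace Y" "closed Y" "range w \<subseteq> Y" "\<And>z. z \<in> Y \<Longrightarrow> (\<And>k. \<phi> k z = 0) \<Longrightarrow> z = 0"
proof -
  let ?g = "rational_combination w"
  let ?Y = "closure (range ?g)"
  define d where "d k = ?g (from_nat k)" for k
  have "\<exists>\<phi>::'a \<Rightarrow>\<^sub>L real. norm \<phi> \<le> 1 \<and> blinfun_apply \<phi> z = norm z" for z :: 'a
    by (metis ex_norming_functional)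
  then have "\<forall>k. \<exists>\<phi>::'a \<Rightarrow>\<^sub>L real. norm \<phi> \<le> 1 \<and> blinfun_apply \<phi> (d k) = norm (d k)"
    by blast
  from choice[OF this] obtain \<phi> :: "nat \<Rightarrow> 'a \<Rightarrow>\<^sub>L real"
    where \<phi>: "\<And>k. norm (\<phi> k) \<le> 1 \<and> \<phi> k (d k) = norm (d k)"
    by blast
  have "range w \<subseteq> ?Y"
  proof safe
    fix i
    have "w i = ?g [(1, i)]"
      by (simp add: rational_combination_def)
    then show "w i \<in> ?Y"
      using closure_subset[of "range ?g"] by auto
  qed
  moreover have "z = 0" if z: "z \<in> ?Y" "\<And>k. \<phi> k z = 0" for z
  proof -
    have "norm z \<le> 0 + e" if "e > 0" for e
    proof -
      have "e / 2 > 0" using that by simp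
      then obtain c where c: "dist (?g c) z < e / 2"
        using z(1) unfolding closure_approachable by blast
      define k where "k = to_nat c"
      have k: "norm (d k - z) < e / 2"
        using c by (simp add: d_def k_def dist_norm)
      have "norm (d k) = \<phi> k (d k - z)"
        using \<phi>[of k] z(2) by (simp add: blinfun.diff_right)
      also have "\<dots> \<le> norm (\<phi> k) * norm (d k - z)"
        using norm_blinfun[of "\<phi> k" "d k - z"] by simp
      also have "\<dots> \<le> 1 * norm (d k - z)"
        using \<phi>[of k] by (intro mult_right_mono) auto
      finally show "norm z \<le> 0 + e"
        using k norm_triangle_sub[of z "d k"] by (simp add: norm_minus_commute)
    qed
    then have "norm z \<le> 0"
      by (rule field_le_epsilon)
    then show "z = 0" by simp
  qed
  ultimately show ?thesis
    using that[of ?Y \<phi>] subspace_closure_rational_combinations[of w] by blast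
qed

text \<open>
  The part \<open>V\<close> of \<open>W\<close> in the closed span of the sequence is weakly compact, because closed
  subspaces are weakly closed, and countably many functionals embed it continuously
  and injectively into the space of real sequences with the product topology, which is
  first countable. A continuous injection of a compact space into a Hausdorff space is a
  homeomorphism onto its image, so a subsequence that converges in the image converges weakly.
\<close>

theorem Eberlein_Smulian:
  fixes w :: "nat \<Rightarrow> 'a::real_normed_vector"
  assumes W: "weakly_compact W" and w: "\<And>n. w n \<in> W"
  obtains l r where "l \<in> W" "strict_mono r" "weakly_tendsto (w \<circ> r) l"
proof -
  obtain Y and \<phi> :: "nat \<Rightarrow> 'a \<Rightarrow>\<^sub>L real"
    where Y: "subspace Y" "closed Y" "range w \<subseteq> Y"
      and sep: "\<And>z. z \<in> Y \<Longrightarrow> (\<And>k. \<phi> k z = 0) \<Longrightarrow> z = 0"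
    by (rule countable_separating_functionals[of w]) blast
  define V where "V = W \<inter> Y"
  have "weakly_compact V"
    using compact_Int_closedin[OF W closedin_weak_closed_subspace[OF Y(1,2)]] by (simp add: V_def)
  then have comp: "compact_space (subtopology weak_topology V)"
    by (simp add: compact_space_subtopology)
  define h where "h x = (\<lambda>k. blinfun_apply (\<phi> k) x)" for x
  have "continuous_map weak_topology (product_topology (\<lambda>_. euclideanreal) UNIV) h"
    by (simp add: continuous_map_componentwise_UNIV h_def continuous_map_weak_functional)
  then have cont: "continuous_map weak_topology euclidean h"
    by (simp add: euclidean_product_topology)
  have inj: "inj_on h V"
  proof (rule inj_onI)
    fix x y assume "x \<in> V" "y \<in> V" and eq: "h x = h y"
    then have "x - y \<in> Y"
      using Y(1) by (auto simp: V_def intro: subspace_diff)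
    moreover have "\<phi> k (x - y) = 0" for k
      using fun_cong[OF eq, of k] by (simp add: h_def blinfun.diff_right)
    ultimately show "x = y"
      using sep by force
  qed
  have "homeomorphic_map (subtopology weak_topology V) (subtopology euclidean (h ` V)) h"
  proof (rule continuous_imp_homeomorphic_map)
    show "continuous_map (subtopology weak_topology V) (subtopology euclidean (h ` V)) h"
      using cont by (auto simp: continuous_map_in_subtopology continuous_map_from_subtopology)
    show "Hausdorff_space (top_of_set (h ` V))"
      by (intro Hausdorff_space_subtopology Hausdorff_space_euclidean)
  qed (use comp inj in auto)
  then obtain g where g: "continuous_map (top_of_set (h ` V)) (subtopology weak_topology V) g"
      "\<And>x. x \<in> V \<Longrightarrow> g (h x) = x"
    unfolding homeomorphic_map_maps homeomorphic_maps_def by auto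
  have "compact (h ` V)"
    using image_compactin[OF \<open>weakly_compact V\<close> cont] by simp
  then have "seq_compact (h ` V)"
    by (rule compact_imp_seq_compact)
  have wV: "w n \<in> V" for n
    using w Y(3) by (auto simp: V_def)
  obtain l r where l: "l \<in> V" and r: "strict_mono (r :: nat \<Rightarrow> nat)"
    and lim: "((\<lambda>n. h (w n)) \<circ> r) \<longlonglongrightarrow> h l"
    by (rule seq_compactE[OF \<open>seq_compact (h ` V)\<close>, of "\<lambda>n. h (w n)"]) (use wV in auto)
  have "limitin (top_of_set (h ` V)) (\<lambda>n. h (w (r n))) (h l) sequentially"
    using lim l wV by (simp add: limitin_subtopology o_def)
  from continuous_map_limit[OF g(1) this]
  have "limitin (subtopology weak_topology V) (w \<circ> r) l sequentially"
    using g(2) l wV by (simp add: o_def)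
  then show ?thesis
    using that l r by (auto simp: limitin_subtopology V_def)
qed

section \<open>Compactness of dual balls and uniform boundedness\<close>

text \<open>
  The weak-* topology of the dual appears as the topology of pointwise convergence on functions. The
  ball is closed in a product of compact intervals, since linearity is a closed condition.
\<close>

lemma Banach_Alaoglu:
  "compact (blinfun_apply ` cball (0 :: 'a::real_normed_vector \<Rightarrow>\<^sub>L real) M)"
proof -
  let ?L = "{f :: 'a \<Rightarrow> real. \<forall>x y. f (x + y) = f x + f y} \<inter> {f. \<forall>c x. f (c *\<^sub>R x) = c * f x}"
  let ?P = "PiE UNIV (\<lambda>x::'a. cball (0::real) (M * norm x))"
  have "compactin (product_topology (\<lambda>_::'a. euclideanreal) UNIV) ?P"
    by (simp add: compactin_PiE)
  then have "compact ?P"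
    by (simp add: euclidean_product_topology)
  moreover have "closed ?L"
    by (intro closed_Int closed_Collect_all closed_Collect_eq continuous_intros) auto
  ultimately have "compact (?P \<inter> ?L)"
    by (rule compact_Int_closed)
  moreover have "blinfun_apply ` cball (0 :: 'a \<Rightarrow>\<^sub>L real) M = (if M < 0 then {} else ?P \<inter> ?L)"
  proof (cases "M < 0")
    case True
    then show ?thesis by simp
  next
    case False
    have 1: "f \<in> blinfun_apply ` cball (0 :: 'a \<Rightarrow>\<^sub>L real) M" if f: "f \<in> ?P \<inter> ?L" for f
    proof -
      have bound: "norm (f x) \<le> M * norm x" for x
        using f by (auto simp: PiE_iff)
      have "bounded_linear f"
        using f bound by (intro bounded_linear_intro[of f M]) (auto simp: mult.commute)
      then have eq: "f = blinfun_apply (Blinfun f)"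
        by (simp add: bounded_linear_Blinfun_apply)
      moreover have "norm (Blinfun f) \<le> M"
        using False bound eq by (intro norm_blinfun_bound) auto
      ultimately show ?thesis by auto
    qed
    have 2: "blinfun_apply \<phi> \<in> ?P \<inter> ?L" if "\<phi> \<in> cball 0 M" for \<phi> :: "'a \<Rightarrow>\<^sub>L real"
    proof -
      have "norm (\<phi> x) \<le> M * norm x" for x
        using norm_blinfun[of \<phi> x] mult_right_mono[of "norm \<phi>" M "norm x"] that by simp
      then show ?thesis
        by (auto simp: blinfun.add_right blinfun.scaleR_right)
    qed
    have "blinfun_apply ` cball (0 :: 'a \<Rightarrow>\<^sub>L real) M = ?P \<inter> ?L"
      by (intro equalityI subsetI image_subsetI) (erule 1 2)+
    then show ?thesis
      using False by simp
  qed
  ultimately show ?thesis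
    by simp
qed

text \<open>
  By the Baire category theorem some set \<open>F m\<close> of points at which the whole family is bounded by \<open>m\<close>
  contains a ball, and differences with its centre carry the bound to all directions.
\<close>

theorem uniform_boundedness:
  fixes \<phi> :: "'i \<Rightarrow> 'a::banach \<Rightarrow>\<^sub>L 'b::real_normed_vector"
  assumes bdd: "\<And>x. bounded (range (\<lambda>i. \<phi> i x))"
  shows "bounded (range \<phi>)"
proof -
  define F where "F m = {x. \<forall>i. norm (\<phi> i x) \<le> real m}" for m :: nat
  have "\<exists>m. x \<in> F m" for x
  proof -
    obtain B where "\<And>i. norm (\<phi> i x) \<le> B"
      using bdd[of x] by (auto simp: bounded_iff)
    moreover obtain m where "B \<le> real m"
      using real_arch_simple by blast
    ultimately show ?thesis
      by (auto simp: F_def intro: order_trans)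
  qed
  then have "(\<Union>m. F m) = UNIV"
    by auto
  then have ne: "interior (\<Union>m. F m) \<noteq> {}"
    by simp
  have closed: "closed (F m)" for m
    unfolding F_def by (intro closed_Collect_all closed_Collect_le continuous_intros)
  have "\<exists>m. interior (F m) \<noteq> {}"
  proof (rule ccontr)
    assume "\<nexists>m. interior (F m) \<noteq> {}"
    then have "euclidean interior_of \<Union>(range F) = {}"
      using closed by (intro Baire_category_alt) (auto simp: completely_metrizable_space_euclidean)
    with ne show False by simp
  qed
  then obtain m where "interior (F m) \<noteq> {}" ..
  then obtain x\<^sub>0 r where r: "r > 0" "cball x\<^sub>0 r \<subseteq> F m"
    unfolding mem_interior_cball ex_in_conv[symmetric] by blast
  have "norm (\<phi> i) \<le> 2 * real m / r" for i
  proof (rule norm_blinfun_bound)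
    show "0 \<le> 2 * real m / r" using r(1) by simp
    fix x
    show "norm (\<phi> i x) \<le> 2 * real m / r * norm x"
    proof (cases "x = 0")
      case False
      define t where "t = r / norm x"
      have t: "t > 0" "norm (t *\<^sub>R x) = r"
        using False r(1) by (auto simp: t_def)
      then have "x\<^sub>0 \<in> F m" "x\<^sub>0 + t *\<^sub>R x \<in> F m"
        using r by (auto intro!: subsetD[OF r(2)] simp: dist_norm)
      then have "norm (\<phi> i (x\<^sub>0 + t *\<^sub>R x) - \<phi> i x\<^sub>0) \<le> 2 * real m"
        unfolding F_def using norm_triangle_ineq4 by (smt (verit) mem_Collect_eq)
      then have "t * norm (\<phi> i x) \<le> 2 * real m"
        using t(1) by (simp add: blinfun.add_right blinfun.scaleR_right)
      then show ?thesis
        using t(1) False r(1) by (simp add: t_def field_simps)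
    qed (simp add: blinfun.zero_right)
  qed
  then show ?thesis
    by (auto simp: bounded_iff)
qed

section \<open>Weak convergence\<close>

lemma weakly_tendsto_real: "weakly_tendsto a l \<longleftrightarrow> a \<longlonglongrightarrow> (l :: real)"
proof
  assume "weakly_tendsto a l"
  from this[unfolded weakly_tendsto_iff, rule_format, of id_blinfun]
  show "a \<longlonglongrightarrow> l" by simp
next
  assume "a \<longlonglongrightarrow> l"
  then show "weakly_tendsto a l"
    unfolding weakly_tendsto_iff by (intro allI blinfun.tendsto tendsto_const)
qed

lemma weakly_tendsto_const: "weakly_tendsto (\<lambda>n. x) x"
  by (simp add: weakly_tendsto_iff)

lemma weakly_tendsto_diff:
  assumes "weakly_tendsto X x" "weakly_tendsto Y y"
  shows "weakly_tendsto (\<lambda>n. X n - Y n) (x - y)"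
  using assms unfolding weakly_tendsto_iff by (auto simp: blinfun.diff_right intro!: tendsto_diff)

lemma weakly_tendsto_bounded_linear:
  assumes h: "bounded_linear h" and X: "weakly_tendsto X x"
  shows "weakly_tendsto (\<lambda>n. h (X n)) (h x)"
  using continuous_map_limit[OF continuous_map_weak_blinfun[of "Blinfun h"] X] h
  by (simp add: o_def bounded_linear_Blinfun_apply)

definition evaluation :: "'a::real_normed_vector \<Rightarrow> ('a \<Rightarrow>\<^sub>L real) \<Rightarrow>\<^sub>L real"
  where "evaluation x = Blinfun (\<lambda>\<phi>. blinfun_apply \<phi> x)"

lemma evaluation_apply [simp]: "evaluation x \<phi> = \<phi> x"
  by (simp add: evaluation_def bounded_linear_Blinfun_apply blinfun.bounded_linear_left)

lemma norm_evaluation_le: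
  fixes x :: "'a::real_normed_vector"
  shows "norm (evaluation x) \<le> norm x"
  using norm_blinfun[of "_ :: 'a \<Rightarrow>\<^sub>L real" x] by (intro norm_blinfun_bound) (auto simp: mult.commute)

lemma weakly_tendsto_dual_pointwise:
  fixes \<phi> :: "nat \<Rightarrow> 'a::real_normed_vector \<Rightarrow>\<^sub>L real"
  assumes "weakly_tendsto \<phi> \<phi>'"
  shows "(\<lambda>n. blinfun_apply (\<phi> n) x) \<longlonglongrightarrow> \<phi>' x"
  using assms[unfolded weakly_tendsto_iff, rule_format, of "evaluation x"] by simp

lemma weakly_convergent_dual_bounded:
  fixes \<phi> :: "nat \<Rightarrow> 'a::banach \<Rightarrow>\<^sub>L real"
  assumes "weakly_tendsto \<phi> \<phi>'"
  shows "bounded (range \<phi>)"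
  using weakly_tendsto_dual_pointwise[OF assms]
  by (intro uniform_boundedness) (auto intro!: convergent_imp_bounded)

lemma tendsto_if_unique_subsequential_limit:
  fixes z :: "nat \<Rightarrow> 'a::metric_space"
  assumes K: "compact K" and z: "\<And>n. z n \<in> K"
    and unique: "\<And>r l'. strict_mono r \<Longrightarrow> (z \<circ> r) \<longlonglongrightarrow> l' \<Longrightarrow> l' = l"
  shows "z \<longlonglongrightarrow> l"
proof (rule ccontr)
  assume "\<not> z \<longlonglongrightarrow> l"
  then obtain e where e: "e > 0" "\<not> (\<forall>\<^sub>F n in sequentially. dist (z n) l < e)"
    unfolding tendsto_iff by auto
  then have "infinite {n. \<not> dist (z n) l < e}"
    by (simp add: eventually_cofinite flip: cofinite_eq_sequentially)
  then obtain s :: "nat \<Rightarrow> nat" where s: "strict_mono s" "\<And>n. \<not> dist (z (s n)) l < e"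
    using infinite_enumerate[of "{n. \<not> dist (z n) l < e}"] by auto
  obtain l' r where r: "strict_mono r" "((\<lambda>n. z (s n)) \<circ> r) \<longlonglongrightarrow> l'"
    by (rule seq_compactE[OF compact_imp_seq_compact[OF K], of "\<lambda>n. z (s n)"]) (use z in auto)
  then have "(z \<circ> (s \<circ> r)) \<longlonglongrightarrow> l"
    using unique[of "s \<circ> r" l'] strict_mono_o[OF s(1) r(1)] by (simp add: o_def)
  from tendstoD[OF this e(1)] obtain n where "dist (z (s (r n))) l < e"
    by (auto simp: eventually_sequentially)
  with s(2) show False by blast
qed

section \<open>The operator of a weakly null sequence of functionals\<close>

text \<open>
  The space \<open>\<ell>\<^sup>\<infinity>\<close> is realised as the bounded continuous functions on the discrete copy of the
  natural numbers. The null sequences form a subspace of it, and the lemmas below describe functionals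
  on \<open>\<ell>\<^sup>\<infinity>\<close> only at null sequences. A sequence that is not bounded gives an unspecified value.
\<close>

definition bounded_sequence :: "(nat \<Rightarrow> real) \<Rightarrow> nat discrete \<Rightarrow>\<^sub>C real"
  where "bounded_sequence a = Bcontfun (\<lambda>d. a (of_discrete d))"

lemma bounded_sequence_apply:
  assumes "bounded (range a)"
  shows "bounded_sequence a d = a (of_discrete d)"
proof -
  have "continuous_on UNIV (\<lambda>d. a (of_discrete d))"
    by (auto simp: continuous_on_open_vimage open_discrete)
  moreover have "bounded (range (\<lambda>d. a (of_discrete d)))"
    by (rule bounded_subset[OF assms]) auto
  ultimately show ?thesis
    by (simp add: bounded_sequence_def Bcontfun_inverse bcontfun_def)
qed

definition unit_sequence :: "nat \<Rightarrow> nat discrete \<Rightarrow>\<^sub>C real"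
  where "unit_sequence k = bounded_sequence (\<lambda>n. if n = k then 1 else 0)"

lemma unit_sequence_apply: "unit_sequence k d = (if of_discrete d = k then 1 else 0)"
  unfolding unit_sequence_def
  by (rule bounded_sequence_apply) (auto intro!: boundedI[of _ 1])

lemma unit_sequence_sum_apply:
  "(\<Sum>k<n. c k *\<^sub>R unit_sequence k) d = (if of_discrete d < n then c (of_discrete d) else 0)"
  by (induction n) (auto simp: unit_sequence_apply less_Suc_eq)

text \<open>
  Testing \<open>\<psi>\<close> on the signs of its own coefficients bounds every partial sum by the norm of \<open>\<psi>\<close>. With
  the next lemma, \<open>\<psi>\<close> acts on null sequences as an element of \<open>\<ell>\<^sup>1\<close>.
\<close>

lemma summable_abs_functional_unit_sequence:
  fixes \<psi> :: "(nat discrete \<Rightarrow>\<^sub>C real) \<Rightarrow>\<^sub>L real"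
  shows "summable (\<lambda>k. \<bar>\<psi> (unit_sequence k)\<bar>)"
proof (rule summableI_nonneg_bounded)
  fix n
  let ?a = "\<lambda>k. \<psi> (unit_sequence k)"
  have "(\<Sum>k<n. \<bar>?a k\<bar>) = \<psi> (\<Sum>k<n. sgn (?a k) *\<^sub>R unit_sequence k)"
    by (simp add: blinfun.sum_right blinfun.scaleR_right abs_sgn mult.commute)
  also have "\<dots> \<le> norm \<psi> * norm (\<Sum>k<n. sgn (?a k) *\<^sub>R unit_sequence k)"
    using norm_blinfun[of \<psi> "\<Sum>k<n. sgn (?a k) *\<^sub>R unit_sequence k"] by simp
  also have "\<dots> \<le> norm \<psi> * 1"
    by (intro mult_left_mono norm_bound) (auto simp: unit_sequence_sum_apply abs_sgn_eq)
  finally show "(\<Sum>k<n. \<bar>?a k\<bar>) \<le> norm \<psi> * 1" .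
qed simp

text \<open>
  The truncations of a null sequence converge to it in the supremum norm.
\<close>

lemma functional_null_sequence_sums:
  fixes \<psi> :: "(nat discrete \<Rightarrow>\<^sub>C real) \<Rightarrow>\<^sub>L real"
  assumes a: "a \<longlonglongrightarrow> 0"
  shows "(\<lambda>k. a k * \<psi> (unit_sequence k)) sums \<psi> (bounded_sequence a)"
proof -
  have bdd: "bounded (range a)"
    using a by (rule convergent_imp_bounded)
  have "(\<lambda>n. \<Sum>k<n. a k *\<^sub>R unit_sequence k) \<longlonglongrightarrow> bounded_sequence a"
  proof (rule LIMSEQ_I)
    fix e :: real assume "e > 0"
    then obtain N where N: "\<And>n. n \<ge> N \<Longrightarrow> norm (a n) < e / 2"
      using LIMSEQ_D[OF a, of "e / 2"] by auto
    have "norm ((\<Sum>k<n. a k *\<^sub>R unit_sequence k) - bounded_sequence a) \<le> e / 2" if "n \<ge> N" for n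
      using N \<open>e > 0\<close> that
      by (intro norm_bound)
         (auto simp: unit_sequence_sum_apply bounded_sequence_apply[OF bdd] not_less
               intro!: less_imp_le)
    then show "\<exists>no. \<forall>n\<ge>no. norm ((\<Sum>k<n. a k *\<^sub>R unit_sequence k) - bounded_sequence a) < e"
      using \<open>e > 0\<close> by (smt (verit) field_sum_of_halves)
  qed
  from blinfun.tendsto[OF tendsto_const this, of \<psi>] show ?thesis
    by (simp add: sums_def blinfun.sum_right blinfun.scaleR_right)
qed

text \<open>
  The vector \<open>u\<close> is the absolutely convergent sum of the \<open>x\<^sub>k\<close> weighted with the coefficients of
  \<open>\<psi>\<close>. The point is that a single \<open>u\<close> serves all \<open>F\<close>: the map from \<open>F\<close> to the sequence \<open>F(x\<^sub>n)\<close>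
  is continuous from the weak-* topology of the dual to the weak topology of \<open>\<ell>\<^sup>\<infinity>\<close>.
\<close>

lemma functional_of_weakly_null_sequence:
  fixes x :: "nat \<Rightarrow> 'b::banach" and \<psi> :: "(nat discrete \<Rightarrow>\<^sub>C real) \<Rightarrow>\<^sub>L real"
  assumes null: "weakly_tendsto x 0" and bdd: "bounded (range x)"
  obtains u where "\<And>F :: 'b \<Rightarrow>\<^sub>L real. \<psi> (bounded_sequence (\<lambda>n. F (x n))) = F u"
proof
  let ?a = "\<lambda>k. \<psi> (unit_sequence k)"
  obtain K where K: "\<And>n. norm (x n) \<le> K"
    using bdd by (auto simp: bounded_iff)
  have "summable (\<lambda>k. norm (?a k *\<^sub>R x k))"
  proof (rule summable_comparison_test')
    show "summable (\<lambda>k. \<bar>?a k\<bar> * K)"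
      by (intro summable_mult2 summable_abs_functional_unit_sequence)
    show "norm (norm (?a k *\<^sub>R x k)) \<le> \<bar>?a k\<bar> * K" if "k \<ge> 0" for k
      using K by (auto intro: mult_left_mono)
  qed
  then have sum: "summable (\<lambda>k. ?a k *\<^sub>R x k)"
    by (rule summable_norm_cancel)
  fix F :: "'b \<Rightarrow>\<^sub>L real"
  have "(\<lambda>k. F (?a k *\<^sub>R x k)) sums F (\<Sum>k. ?a k *\<^sub>R x k)"
    by (rule bounded_linear.sums[OF blinfun.bounded_linear_right summable_sums[OF sum]])
  moreover have "(\<lambda>n. F (x n)) \<longlonglongrightarrow> 0"
    using null by (simp add: weakly_tendsto_iff blinfun.zero_right)
  ultimately show "\<psi> (bounded_sequence (\<lambda>n. F (x n))) = F (\<Sum>k. ?a k *\<^sub>R x k)"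
    using functional_null_sequence_sums[of "\<lambda>n. F (x n)" \<psi>]
    by (auto simp: blinfun.scaleR_right mult.commute dest: sums_unique2)
qed

text \<open>
  The map \<open>\<Phi>\<close> extends the operator \<open>S\<close> to the bidual, and it is continuous there from the weak-* to
  the weak topology by the previous lemma. So it maps balls of the bidual, compact by
  Banach--Alaoglu, to weakly compact sets that contain the images of bounded sets under \<open>S\<close>.
\<close>

lemma weakly_null_sequence_operator:
  fixes \<phi> :: "nat \<Rightarrow> 'a::banach \<Rightarrow>\<^sub>L real"
  assumes null: "weakly_tendsto \<phi> 0"
  obtains S :: "'a \<Rightarrow>\<^sub>L nat discrete \<Rightarrow>\<^sub>C real"
    where "weakly_compact_operator S" "\<And>x n. S x (discrete n) = \<phi> n x"
proof -
  have bdd: "bounded (range \<phi>)"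
    using null by (rule weakly_convergent_dual_bounded)
  then obtain K where K: "\<And>n. norm (\<phi> n) \<le> K"
    by (auto simp: bounded_iff)
  have F_le: "norm (F (\<phi> n)) \<le> norm F * K" for F :: "('a \<Rightarrow>\<^sub>L real) \<Rightarrow>\<^sub>L real" and n
    by (rule order_trans[OF norm_blinfun]) (intro mult_left_mono K norm_ge_zero)
  define \<Phi> where "\<Phi> F = bounded_sequence (\<lambda>n. F (\<phi> n))" for F :: "('a \<Rightarrow>\<^sub>L real) \<Rightarrow> real"
  have \<Phi>: "\<Phi> F d = F (\<phi> (of_discrete d))" for F :: "('a \<Rightarrow>\<^sub>L real) \<Rightarrow>\<^sub>L real" and d
    unfolding \<Phi>_def using F_le by (intro bounded_sequence_apply boundedI) auto
  have "bounded_linear (\<lambda>x. \<Phi> (evaluation x))"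
  proof (rule bounded_linear_intro)
    show "norm (\<Phi> (evaluation x)) \<le> norm x * K" for x
    proof (rule norm_bound)
      fix d
      have "norm (\<phi> (of_discrete d) x) \<le> norm (\<phi> (of_discrete d)) * norm x"
        by (rule norm_blinfun)
      also have "\<dots> \<le> K * norm x"
        by (intro mult_right_mono K) auto
      finally show "norm (\<Phi> (evaluation x) d) \<le> norm x * K"
        by (simp add: \<Phi> mult.commute)
    qed
  qed (auto intro!: bcontfun_eqI simp: \<Phi> blinfun.add_right blinfun.scaleR_right)
  then have S: "Blinfun (\<lambda>x. \<Phi> (evaluation x)) x = \<Phi> (evaluation x)" for x
    by (simp add: bounded_linear_Blinfun_apply)
  \<comment> \<open>The weak-* topology lives on the underlying functions, so \<open>\<Phi>\<close> is defined on all functions.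
    The previous lemma gives its continuity on the range of \<open>blinfun_apply\<close>, which
    contains the balls.\<close>
  have comp: "weakly_compact (\<Phi> ` blinfun_apply ` cball 0 M)" for M
  proof (rule image_compactin)
    show "compactin (top_of_set (range blinfun_apply))
            (blinfun_apply ` cball (0 :: ('a \<Rightarrow>\<^sub>L real) \<Rightarrow>\<^sub>L real) M)"
      by (auto simp: compactin_subtopology Banach_Alaoglu)
    show "continuous_map (top_of_set (range blinfun_apply)) weak_topology \<Phi>"
    proof (rule continuous_map_into_weak_topology)
      fix \<psi> :: "(nat discrete \<Rightarrow>\<^sub>C real) \<Rightarrow>\<^sub>L real"
      obtain u where u: "\<And>F :: ('a \<Rightarrow>\<^sub>L real) \<Rightarrow>\<^sub>L real. \<psi> (bounded_sequence (\<lambda>n. F (\<phi> n))) = F u"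
        by (rule functional_of_weakly_null_sequence[OF null bdd, of \<psi>]) blast
      have "continuous_map (top_of_set (range blinfun_apply)) euclideanreal
              (\<lambda>F :: ('a \<Rightarrow>\<^sub>L real) \<Rightarrow> real. F u)"
        by (auto intro: continuous_on_subset[OF continuous_on_product_coordinates])
      then show "continuous_map (top_of_set (range blinfun_apply)) euclideanreal
              (\<lambda>F. \<psi> (\<Phi> F))"
        by (rule continuous_map_eq) (auto simp: \<Phi>_def u)
    qed
  qed
  have "weakly_compact_operator (Blinfun (\<lambda>x. \<Phi> (evaluation x)))"
    unfolding weakly_compact_operator_def S[abs_def]
  proof (intro allI impI)
    fix A :: "'a set" assume "bounded A"
    then obtain M where M: "\<And>x. x \<in> A \<Longrightarrow> norm x \<le> M"
      by (auto simp: bounded_iff)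
    have "norm (evaluation x) \<le> M" if "x \<in> A" for x
      using norm_evaluation_le M[OF that] by (rule order_trans)
    then have "(\<lambda>x. \<Phi> (evaluation x)) ` A \<subseteq> \<Phi> ` blinfun_apply ` cball 0 M"
      by (auto intro!: imageI)
    then have "weak_topology closure_of ((\<lambda>x. \<Phi> (evaluation x)) ` A) \<subseteq> \<Phi> ` blinfun_apply ` cball 0 M"
      by (rule closure_of_minimal) (rule compactin_imp_closedin[OF Hausdorff_weak_topology comp])
    then show "weakly_compact (weak_topology closure_of ((\<lambda>x. \<Phi> (evaluation x)) ` A))"
      by (rule closed_compactin[OF comp]) simp
  qed
  then show ?thesis
    by (rule that) (simp add: S \<Phi> discrete_inverse)
qed

section \<open>Gantmacher's theorem\<close>

text \<open>
  The supremum of \<open>\<phi>\<close> over the ball of radius \<open>norm F\<close> is \<open>norm F * norm \<phi>\<close>.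
\<close>

lemma bidual_le_bound_on_ball:
  fixes F :: "('a::real_normed_vector \<Rightarrow>\<^sub>L real) \<Rightarrow>\<^sub>L real" and \<phi> :: "'a \<Rightarrow>\<^sub>L real"
  assumes c: "\<And>x. norm x \<le> norm F \<Longrightarrow> \<phi> x \<le> c"
  shows "F \<phi> \<le> c"
proof (cases "norm F = 0")
  case True
  then show ?thesis
    using c[of 0] by (simp add: blinfun.zero_right)
next
  case False
  then have pos: "norm F > 0" by simp
  have "0 \<le> c"
    using c[of 0] by (simp add: blinfun.zero_right)
  have "norm \<phi> \<le> c / norm F"
  proof (rule norm_blinfun_bound)
    show "0 \<le> c / norm F"
      using \<open>0 \<le> c\<close> by simp
    fix x
    show "norm (\<phi> x) \<le> c / norm F * norm x"
    proof (cases "x = 0")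
      case False
      define t where "t = norm F / norm x"
      have t: "t > 0" "norm (t *\<^sub>R x) = norm F"
        using False pos by (auto simp: t_def)
      have "t * \<phi> x \<le> c" "- (t * \<phi> x) \<le> c"
        using c[of "t *\<^sub>R x"] c[of "- t *\<^sub>R x"] t
        by (simp_all add: blinfun.scaleR_right blinfun.minus_right)
      then have "t * norm (\<phi> x) \<le> c"
        using t(1) by (simp add: abs_if)
      then show ?thesis
        using False pos by (simp add: t_def field_simps)
    qed (simp add: blinfun.zero_right)
  qed
  then have "norm F * norm \<phi> \<le> c"
    using pos by (simp add: field_simps)
  then show ?thesis
    using norm_blinfun[of F \<phi>] by simp
qed

text \<open>
  The homothety of ratio \<open>1 - t\<close> centred at \<open>S x\<close> is weakly continuous and preserves the image of
  the convex set \<open>A\<close>, hence also the weak closure of that image.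
\<close>

lemma segment_in_weak_closure:
  fixes S :: "'a::real_normed_vector \<Rightarrow>\<^sub>L 'z::real_normed_vector"
  assumes A: "convex A" and x: "x \<in> A" and t: "0 \<le> t" "t \<le> 1"
    and k: "k \<in> weak_topology closure_of (S ` A)"
  shows "(1 - t) *\<^sub>R k + t *\<^sub>R S x \<in> weak_topology closure_of (S ` A)"
proof -
  let ?f = "\<lambda>z. (1 - t) *\<^sub>R z + t *\<^sub>R S x"
  have "continuous_map weak_topology weak_topology ?f"
    by (rule continuous_map_into_weak_topology)
       (auto simp: blinfun.add_right blinfun.scaleR_right
             intro!: continuous_intros continuous_map_real_mult continuous_map_weak_functional)
  from continuous_map_image_closure_subset[OF this, of "S ` A"]
  have "?f k \<in> weak_topology closure_of (?f ` S ` A)"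
    using k by blast
  moreover have "?f ` S ` A \<subseteq> S ` A"
  proof safe
    fix y assume "y \<in> A"
    then have "(1 - t) *\<^sub>R y + t *\<^sub>R x \<in> A"
      using convexD_alt[OF A _ x, of y t] t by simp
    then show "?f (S y) \<in> S ` A"
      by (rule rev_image_eqI) (simp add: blinfun.add_right blinfun.scaleR_right)
  qed
  ultimately show ?thesis
    using closure_of_mono by blast
qed

text \<open>
  The first order condition at \<open>t = 0\<close> for a minimum over the interval from \<open>0\<close> to \<open>1\<close>.
\<close>

lemma nonpos_if_quadratic_nonneg:
  fixes a q :: real
  assumes "\<And>t. 0 < t \<Longrightarrow> t \<le> 1 \<Longrightarrow> 2 * t * a \<le> t\<^sup>2 * q"
  shows "a \<le> 0"
proof (rule ccontr)
  assume "\<not> a \<le> 0"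
  define t where "t = min 1 (a / (\<bar>q\<bar> + 1))"
  have t: "0 < t" "t \<le> 1"
    using \<open>\<not> a \<le> 0\<close> by (auto simp: t_def)
  have "t * (2 * a) \<le> t * (t * q)"
    using assms[OF t] by (simp add: power2_eq_square algebra_simps)
  then have "2 * a \<le> t * q"
    using t(1) by simp
  also have "t * q \<le> t * (\<bar>q\<bar> + 1)"
    using t by (intro mult_left_mono) auto
  also have "\<dots> \<le> a / (\<bar>q\<bar> + 1) * (\<bar>q\<bar> + 1)"
    by (intro mult_right_mono) (auto simp: t_def)
  also have "\<dots> = a" by simp
  finally show False
    using \<open>\<not> a \<le> 0\<close> by simp
qed

text \<open>
  Here \<open>k\<close> plays the role of the value at \<open>F\<close> of the second adjoint of \<open>S\<close>, tested on finitely many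
  functionals. It is found by minimising over the weakly compact set \<open>K\<close> the squared distance \<open>g\<close>
  between the two sides. Let \<open>a \<psi>\<close> be the defects at a minimiser \<open>k\<close> and let \<open>\<xi>\<close> be the sum of the
  \<open>\<psi>\<close> weighted with them. Moving from \<open>k\<close> towards \<open>S x\<close> does not decrease \<open>g\<close>, which says that
  \<open>\<xi> (S x) \<le> \<xi> k\<close> on the ball of radius \<open>norm F\<close>. Therefore \<open>F (\<xi> \<circ> S) \<le> \<xi> k\<close>, whereas the definition
  of the defects gives \<open>F (\<xi> \<circ> S) = g k + \<xi> k\<close>, so \<open>g k\<close> vanishes. This replaces Goldstine's theorem
  and the separation of convex sets.
\<close>

lemma bidual_value_finite:
  fixes S :: "'a::real_normed_vector \<Rightarrow>\<^sub>L 'z::real_normed_vector"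
    and F :: "('a \<Rightarrow>\<^sub>L real) \<Rightarrow>\<^sub>L real"
  defines "K \<equiv> weak_topology closure_of (S ` cball 0 (norm F))"
  assumes K: "weakly_compact K" and fin: "finite \<Psi>"
  obtains k where "k \<in> K" "\<And>\<psi>. \<psi> \<in> \<Psi> \<Longrightarrow> F (\<psi> o\<^sub>L S) = blinfun_apply \<psi> k"
proof -
  define g where "g k = (\<Sum>\<psi>\<in>\<Psi>. (F (\<psi> o\<^sub>L S) - blinfun_apply \<psi> k)\<^sup>2)" for k
  have "continuous_map weak_topology euclideanreal g"
    unfolding g_def using fin
    by (intro continuous_map_sum continuous_map_real_pow continuous_map_diff
          continuous_map_weak_functional) auto
  then have "compact (g ` K)"
    using image_compactin[OF K] by fastforce
  moreover have in_K: "S x \<in> K" if "norm x \<le> norm F" for x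
    unfolding K_def using that closure_of_subset[of "S ` cball 0 (norm F)" weak_topology] by auto
  then have "g ` K \<noteq> {}"
    using in_K[of 0] by auto
  ultimately obtain k where k: "k \<in> K" and min: "\<And>k'. k' \<in> K \<Longrightarrow> g k \<le> g k'"
    using compact_attains_inf[of "g ` K"] by auto
  define a where "a \<psi> = F (\<psi> o\<^sub>L S) - blinfun_apply \<psi> k" for \<psi>
  define \<xi> where "\<xi> = (\<Sum>\<psi>\<in>\<Psi>. a \<psi> *\<^sub>R \<psi>)"
  have \<xi>: "\<xi> z = (\<Sum>\<psi>\<in>\<Psi>. a \<psi> * blinfun_apply \<psi> z)" for z
    by (simp add: \<xi>_def blinfun.sum_left blinfun.scaleR_left)
  have le: "(\<xi> o\<^sub>L S) x \<le> \<xi> k" if x: "norm x \<le> norm F" for x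
  proof -
    let ?v = "S x - k"
    have "\<xi> ?v \<le> 0"
    proof (rule nonpos_if_quadratic_nonneg)
      fix t :: real assume t: "0 < t" "t \<le> 1"
      have "(1 - t) *\<^sub>R k + t *\<^sub>R S x \<in> K"
        using k x t unfolding K_def by (intro segment_in_weak_closure) auto
      then have "g k \<le> g (k + t *\<^sub>R ?v)"
        by (intro min) (simp add: algebra_simps)
      also have "g (k + t *\<^sub>R ?v) = (\<Sum>\<psi>\<in>\<Psi>. (a \<psi> - t * blinfun_apply \<psi> ?v)\<^sup>2)"
        by (simp add: g_def a_def blinfun.add_right blinfun.scaleR_right diff_diff_eq)
      also have "\<dots> = (\<Sum>\<psi>\<in>\<Psi>. (a \<psi>)\<^sup>2 - 2 * t * (a \<psi> * blinfun_apply \<psi> ?v)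
                         + t\<^sup>2 * (blinfun_apply \<psi> ?v)\<^sup>2)"
        by (intro sum.cong) (auto simp: power2_diff power_mult_distrib)
      also have "\<dots> = g k - 2 * t * \<xi> ?v + t\<^sup>2 * (\<Sum>\<psi>\<in>\<Psi>. (blinfun_apply \<psi> ?v)\<^sup>2)"
        by (simp add: sum.distrib sum_subtractf sum_distrib_left g_def a_def \<xi>)
      finally show "2 * t * \<xi> ?v \<le> t\<^sup>2 * (\<Sum>\<psi>\<in>\<Psi>. (blinfun_apply \<psi> ?v)\<^sup>2)"
        by simp
    qed
    then show ?thesis
      by (simp add: blinfun.diff_right)
  qed
  have "F (\<xi> o\<^sub>L S) \<le> \<xi> k"
    by (rule bidual_le_bound_on_ball[OF le])
  moreover have "\<xi> o\<^sub>L S = (\<Sum>\<psi>\<in>\<Psi>. a \<psi> *\<^sub>R (\<psi> o\<^sub>L S))"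
    by (rule blinfun_eqI) (simp add: \<xi> blinfun.sum_left blinfun.scaleR_left)
  then have "F (\<xi> o\<^sub>L S) = (\<Sum>\<psi>\<in>\<Psi>. a \<psi> * (a \<psi> + blinfun_apply \<psi> k))"
    by (simp add: blinfun.sum_right blinfun.scaleR_right a_def)
  then have "F (\<xi> o\<^sub>L S) = (\<Sum>\<psi>\<in>\<Psi>. (a \<psi>)\<^sup>2) + \<xi> k"
    by (simp add: \<xi> distrib_left sum.distrib power2_eq_square)
  ultimately have "(\<Sum>\<psi>\<in>\<Psi>. (a \<psi>)\<^sup>2) = 0"
    using sum_nonneg[of \<Psi> "\<lambda>\<psi>. (a \<psi>)\<^sup>2"] by simp
  then have "F (\<psi> o\<^sub>L S) = blinfun_apply \<psi> k" if "\<psi> \<in> \<Psi>" for \<psi>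
    using fin that by (auto simp: sum_nonneg_eq_0_iff a_def)
  with k show ?thesis
    by (rule that)
qed

text \<open>
  All functionals are served at once by the finite intersection property of the weak closure of the
  image of a ball: the second adjoint of a weakly compact operator takes its values in the
  target space itself.
\<close>

lemma bidual_value_exists:
  fixes S :: "'a::real_normed_vector \<Rightarrow>\<^sub>L 'z::real_normed_vector"
    and F :: "('a \<Rightarrow>\<^sub>L real) \<Rightarrow>\<^sub>L real"
  assumes S: "weakly_compact_operator S"
  shows "\<exists>k. \<forall>\<psi> :: 'z \<Rightarrow>\<^sub>L real. F (\<psi> o\<^sub>L S) = blinfun_apply \<psi> k"
proof -
  let ?K = "weak_topology closure_of (S ` cball 0 (norm F))"
  let ?H = "\<lambda>\<psi> :: 'z \<Rightarrow>\<^sub>L real. {k. blinfun_apply \<psi> k = F (\<psi> o\<^sub>L S)}"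
  have K: "weakly_compact ?K"
    using S by (simp add: weakly_compact_operator_def)
  have fip: "?K \<inter> \<Inter>\<F> \<noteq> {}" if \<F>: "finite \<F>" "\<F> \<subseteq> range ?H" for \<F>
  proof -
    obtain \<Psi> where \<Psi>: "finite \<Psi>" "\<F> = ?H ` \<Psi>"
      using finite_subset_image[OF \<F>] by auto
    obtain k where "k \<in> ?K" "\<And>\<psi>. \<psi> \<in> \<Psi> \<Longrightarrow> F (\<psi> o\<^sub>L S) = blinfun_apply \<psi> k"
      by (rule bidual_value_finite[OF K \<Psi>(1)]) blast
    with \<Psi>(2) show ?thesis by auto
  qed
  have "?K \<inter> \<Inter>(range ?H) \<noteq> {}"
  proof (rule K[unfolded compactin_fip, THEN conjunct2, THEN spec, THEN mp], intro conjI ballI allI impI)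
    show "closedin weak_topology C" if "C \<in> range ?H" for C
      using that closedin_weak_functional by auto
  qed (use fip in auto)
  then obtain k where "k \<in> (\<Inter>\<psi>. ?H \<psi>)"
    by (auto simp only: ex_in_conv[symmetric] Int_iff)
  then have "F (\<psi> o\<^sub>L S) = blinfun_apply \<psi> k" for \<psi>
    by simp
  then show ?thesis by (intro exI allI)
qed

text \<open>
  By the previous lemma the adjoint \<open>\<psi> \<mapsto> \<psi> \<circ> S\<close> is continuous from the weak-* topology to the weak
  topology of the dual, so it maps balls to weakly compact sets.
\<close>

theorem Gantmacher:
  fixes S :: "'a::real_normed_vector \<Rightarrow>\<^sub>L 'z::real_normed_vector"
  assumes S: "weakly_compact_operator S"
  shows "weakly_compact ((\<lambda>\<psi> :: 'z \<Rightarrow>\<^sub>L real. \<psi> o\<^sub>L S) ` cball 0 M)"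
proof -
  define \<Theta> where "\<Theta> G = Blinfun G o\<^sub>L S" for G :: "'z \<Rightarrow> real"
  have \<Theta>: "\<Theta> (blinfun_apply \<psi>) = \<psi> o\<^sub>L S" for \<psi>
    by (simp add: \<Theta>_def blinfun_apply_inverse)
  have "weakly_compact (\<Theta> ` blinfun_apply ` cball 0 M)"
  proof (rule image_compactin)
    show "compactin (top_of_set (range blinfun_apply))
            (blinfun_apply ` cball (0 :: 'z \<Rightarrow>\<^sub>L real) M)"
      by (auto simp: compactin_subtopology Banach_Alaoglu)
    show "continuous_map (top_of_set (range blinfun_apply)) weak_topology \<Theta>"
    proof (rule continuous_map_into_weak_topology)
      fix F :: "('a \<Rightarrow>\<^sub>L real) \<Rightarrow>\<^sub>L real"
      obtain k where k: "\<And>\<psi> :: 'z \<Rightarrow>\<^sub>L real. F (\<psi> o\<^sub>L S) = blinfun_apply \<psi> k"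
        using bidual_value_exists[OF S] by blast
      have "continuous_map (top_of_set (range blinfun_apply)) euclideanreal (\<lambda>G :: 'z \<Rightarrow> real. G k)"
        by (auto intro: continuous_on_subset[OF continuous_on_product_coordinates])
      then show "continuous_map (top_of_set (range blinfun_apply)) euclideanreal (\<lambda>G. F (\<Theta> G))"
        by (rule continuous_map_eq) (auto simp: \<Theta> k)
    qed
  qed
  then show ?thesis
    by (simp add: image_image \<Theta>)
qed

section \<open>The Dunford--Pettis property and the duality pairing\<close>

text \<open>
  The functional \<open>\<phi> n\<close> is a coordinate of the operator \<open>S\<close>, so it is enough that \<open>S (x n)\<close> tends to
  \<open>0\<close> in norm. The images lie in a norm compact set, and weak convergence of \<open>x\<close> makes \<open>0\<close> the only
  possible limit of a subsequence.
\<close>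

lemma dunford_pettis_null_pairing:
  fixes \<phi> :: "nat \<Rightarrow> 'a::banach \<Rightarrow>\<^sub>L real" and x :: "nat \<Rightarrow> 'a"
  assumes dp: "dunford_pettis TYPE('a)"
    and \<phi>: "weakly_tendsto \<phi> 0" and x: "weakly_tendsto x 0"
  shows "(\<lambda>n. \<phi> n (x n)) \<longlonglongrightarrow> 0"
proof -
  obtain S :: "'a \<Rightarrow>\<^sub>L nat discrete \<Rightarrow>\<^sub>C real"
    where S: "weakly_compact_operator S" and S_apply: "\<And>x n. S x (discrete n) = \<phi> n x"
    by (rule weakly_null_sequence_operator[OF \<phi>]) blast
  let ?W = "insert 0 (range x)"
  have "weakly_compact ?W"
    by (rule compactin_sequence_with_limit[OF x]) auto
  then have comp: "compact (S ` ?W)"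
    using dunford_pettis_imp_into[OF dp, where 'z = "nat discrete \<Rightarrow>\<^sub>C real"] S
    unfolding dunford_pettis_into_def by blast
  have "(\<lambda>n. S (x n)) \<longlonglongrightarrow> 0"
  proof (rule tendsto_if_unique_subsequential_limit[OF comp])
    fix r l assume r: "strict_mono (r :: nat \<Rightarrow> nat)" and l: "((\<lambda>n. S (x n)) \<circ> r) \<longlonglongrightarrow> l"
    show "l = 0"
    proof (rule bcontfun_eqI)
      fix d :: "nat discrete"
      obtain k where d: "d = discrete k"
        by (metis of_discrete_inverse)
      have "(\<lambda>n. norm (S (x (r n)) - l)) \<longlonglongrightarrow> 0"
        using l by (simp add: o_def LIM_zero tendsto_norm_zero)
      then have "(\<lambda>n. S (x (r n)) d - l d) \<longlonglongrightarrow> 0"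
        by (rule Lim_null_comparison[rotated])
           (use norm_bounded[of "S (x (r _)) - l" d] in auto)
      moreover have "(\<lambda>n. S (x (r n)) d) \<longlonglongrightarrow> 0"
        using limitin_subsequence[OF r x]
        by (simp add: weakly_tendsto_iff S_apply d o_def blinfun.zero_right)
      ultimately show "l d = (0 :: nat discrete \<Rightarrow>\<^sub>C real) d"
        using LIMSEQ_unique LIM_zero_cancel by (metis zero_bcontfun.rep_eq)
    qed
  qed auto
  then have lim: "(\<lambda>n. norm (S (x n))) \<longlonglongrightarrow> 0"
    by (rule tendsto_norm_zero)
  have "norm (\<phi> n (x n)) \<le> norm (S (x n))" for n
    using norm_bounded[of "S (x n)" "discrete n"] by (simp add: S_apply)
  then show ?thesis
    by (intro Lim_null_comparison[OF _ lim]) auto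
qed

theorem dunford_pettis_imp_pairing_weakly_seq_continuous:
  assumes dp: "dunford_pettis TYPE('a::banach)"
  shows "weakly_seq_continuous2 (blinfun_apply :: ('a \<Rightarrow>\<^sub>L real) \<Rightarrow> 'a \<Rightarrow> real)"
  unfolding weakly_seq_continuous2_def weakly_tendsto_real
proof (intro allI impI)
  fix \<phi> \<phi>' and x :: "nat \<Rightarrow> 'a" and x'
  assume \<phi>: "weakly_tendsto \<phi> (\<phi>' :: 'a \<Rightarrow>\<^sub>L real)" and x: "weakly_tendsto x x'"
  have "(\<lambda>n. (\<phi> n - \<phi>') (x n - x') + (\<phi> n - \<phi>') x' + \<phi>' (x n)) \<longlonglongrightarrow> 0 + 0 + \<phi>' x'"
  proof (intro tendsto_add)
    show "(\<lambda>n. (\<phi> n - \<phi>') (x n - x')) \<longlonglongrightarrow> 0"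
      using weakly_tendsto_diff[OF \<phi> weakly_tendsto_const[of \<phi>']]
        weakly_tendsto_diff[OF x weakly_tendsto_const[of x']]
      by (intro dunford_pettis_null_pairing[OF dp]) simp_all
    show "(\<lambda>n. (\<phi> n - \<phi>') x') \<longlonglongrightarrow> 0"
      using weakly_tendsto_dual_pointwise[OF \<phi>, of x'] by (simp add: blinfun.diff_left LIM_zero)
    show "(\<lambda>n. \<phi>' (x n)) \<longlonglongrightarrow> \<phi>' x'"
      using x by (simp add: weakly_tendsto_iff)
  qed
  then show "(\<lambda>n. \<phi> n (x n)) \<longlonglongrightarrow> \<phi>' x'"
    by (simp add: blinfun.diff_left blinfun.diff_right)
qed

text \<open>
  Two extractions are needed: a weakly convergent subsequence in \<open>W\<close>, and then one of the
  functionals \<open>\<psi> n \<circ> S\<close>, where \<open>\<psi> n\<close> norms the image of the remaining error \<open>v n\<close>. Along the second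
  subsequence the norms of these images are values of the pairing and tend to \<open>\<phi> 0 = 0\<close>.
\<close>

theorem pairing_weakly_seq_continuous_imp_dunford_pettis_into:
  assumes P: "weakly_seq_continuous2 (blinfun_apply :: ('a::banach \<Rightarrow>\<^sub>L real) \<Rightarrow> 'a \<Rightarrow> real)"
  shows "dunford_pettis_into TYPE('a) TYPE('z::banach)"
  unfolding dunford_pettis_into_def
proof (intro allI impI)
  fix S :: "'a \<Rightarrow>\<^sub>L 'z" and W :: "'a set"
  assume S: "weakly_compact_operator S" and W: "weakly_compact W"
  have "seq_compact (S ` W)"
  proof (rule seq_compactI)
    fix f :: "nat \<Rightarrow> 'z" assume f: "\<forall>n. f n \<in> S ` W"
    then have "\<forall>n. \<exists>x. x \<in> W \<and> f n = S x"
      by blast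
    then obtain w where w: "\<And>n. w n \<in> W" "\<And>n. f n = S (w n)"
      by metis
    obtain x and r :: "nat \<Rightarrow> nat" where x: "x \<in> W" and r: "strict_mono r" "weakly_tendsto (w \<circ> r) x"
      by (rule Eberlein_Smulian[OF W w(1)])
    define v where "v n = w (r n) - x" for n
    have v: "weakly_tendsto v 0"
      using weakly_tendsto_diff[OF r(2) weakly_tendsto_const[of x]] by (simp add: v_def[abs_def])
    have "\<forall>n. \<exists>\<psi> :: 'z \<Rightarrow>\<^sub>L real. norm \<psi> \<le> 1 \<and> blinfun_apply \<psi> (S (v n)) = norm (S (v n))"
      using ex_norming_functional by metis
    then obtain \<psi> :: "nat \<Rightarrow> 'z \<Rightarrow>\<^sub>L real"
      where \<psi>: "\<And>n. norm (\<psi> n) \<le> 1" "\<And>n. \<psi> n (S (v n)) = norm (S (v n))"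
      by metis
    have "\<psi> n o\<^sub>L S \<in> (\<lambda>\<psi> :: 'z \<Rightarrow>\<^sub>L real. \<psi> o\<^sub>L S) ` cball 0 1" for n
      using \<psi>(1) by auto
    then obtain \<phi> and s :: "nat \<Rightarrow> nat" where s: "strict_mono s" "weakly_tendsto ((\<lambda>n. \<psi> n o\<^sub>L S) \<circ> s) \<phi>"
      by (rule Eberlein_Smulian[OF Gantmacher[OF S]])
    have "(\<lambda>n. (\<psi> (s n) o\<^sub>L S) (v (s n))) \<longlonglongrightarrow> \<phi> 0"
      using P s(2) limitin_subsequence[OF s(1) v]
      unfolding weakly_seq_continuous2_def weakly_tendsto_real o_def by blast
    then have "(\<lambda>n. norm (S (v (s n)))) \<longlonglongrightarrow> 0"
      by (simp add: \<psi>(2) blinfun.zero_right)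
    then have "(\<lambda>n. S (w (r (s n))) - S x) \<longlonglongrightarrow> 0"
      by (simp add: v_def blinfun.diff_right tendsto_norm_zero_iff)
    then have "(f \<circ> (r \<circ> s)) \<longlonglongrightarrow> S x"
      by (simp add: o_def w(2) LIM_zero_iff)
    then show "\<exists>l\<in>S ` W. \<exists>r. strict_mono r \<and> (f \<circ> r) \<longlonglongrightarrow> l"
      using x strict_mono_o[OF r(1) s(1)] by blast
  qed
  then show "compact (S ` W)"
    by (simp add: compact_eq_seq_compact_metric)
qed

corollary dunford_pettis_iff_pairing_weakly_seq_continuous:
  "dunford_pettis TYPE('a::banach) \<longleftrightarrow>
    weakly_seq_continuous2 (blinfun_apply :: ('a \<Rightarrow>\<^sub>L real) \<Rightarrow> 'a \<Rightarrow> real)"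
  using dunford_pettis_imp_pairing_weakly_seq_continuous
    pairing_weakly_seq_continuous_imp_dunford_pettis_into
  unfolding dunford_pettis_def by blast

section \<open>Compact operators\<close>

lemma bounded_linear_blinfun_of_compact_op: "bounded_linear blinfun_of_compact_op"
  by (rule bounded_linear_intro[of _ 1])
     (simp_all add: plus_compact_op.rep_eq scaleR_compact_op.rep_eq norm_compact_op.rep_eq)

definition rank_one :: "('a::real_normed_vector \<Rightarrow>\<^sub>L real) \<Rightarrow> 'b::real_normed_vector \<Rightarrow> 'a \<Rightarrow>\<^sub>K 'b"
  where "rank_one \<phi> e = Compact_op (blinfun_scaleR_left e o\<^sub>L \<phi>)"

lemma blinfun_of_rank_one: "blinfun_of_compact_op (rank_one \<phi> e) = blinfun_scaleR_left e o\<^sub>L \<phi>"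
proof -
  have "compact (closure ((blinfun_scaleR_left e o\<^sub>L \<phi>) ` A))" if "bounded A" for A
  proof -
    have "bounded (\<phi> ` A)"
      by (rule bounded_linear_image[OF that]) (rule blinfun.bounded_linear_right)
    then have "compact (closure (\<phi> ` A))"
      by simp
    then have "compact (blinfun_scaleR_left e ` closure (\<phi> ` A))"
      by (intro compact_continuous_image continuous_intros)
    moreover have "(blinfun_scaleR_left e o\<^sub>L \<phi>) ` A \<subseteq> blinfun_scaleR_left e ` closure (\<phi> ` A)"
      using closure_subset[of "\<phi> ` A"] by auto
    ultimately show ?thesis
      by (rule compact_closure_subset)
  qed
  then show ?thesis
    by (simp add: rank_one_def Compact_op_inverse compact_operator_def)
qed

lemma compact_op_apply_rank_one: "compact_op_apply (rank_one \<phi> e) x = \<phi> x *\<^sub>R e"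
  by (simp add: compact_op_apply_def blinfun_of_rank_one blinfun_scaleR_left.rep_eq)

lemma bounded_linear_rank_one: "bounded_linear (\<lambda>\<phi>. rank_one \<phi> e)"
proof (rule bounded_linear_intro)
  interpret compose: bounded_bilinear "(o\<^sub>L)"
    by (rule bounded_bilinear_blinfun_compose)
  show "rank_one (\<phi> + \<psi>) e = rank_one \<phi> e + rank_one \<psi> e" for \<phi> \<psi>
    unfolding blinfun_of_compact_op_inject[symmetric] plus_compact_op.rep_eq blinfun_of_rank_one
    by (rule compose.add_right)
  show "rank_one (c *\<^sub>R \<phi>) e = c *\<^sub>R rank_one \<phi> e" for c \<phi>
    unfolding blinfun_of_compact_op_inject[symmetric] scaleR_compact_op.rep_eq blinfun_of_rank_one
    by (rule compose.scaleR_right)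
  show "norm (rank_one \<phi> e) \<le> norm \<phi> * norm (blinfun_scaleR_left e)" for \<phi>
    unfolding norm_compact_op.rep_eq blinfun_of_rank_one
    using norm_blinfun_compose[of "blinfun_scaleR_left e" \<phi>] by (simp add: mult.commute)
qed

text \<open>
  Bounded linear maps preserve weak convergence. Applied to \<open>\<phi> \<mapsto> rank_one \<phi> e\<close> and to
  \<open>X \<mapsto> \<psi> \<circ> X\<close>, this transfers sequential continuity from operators to functionals and back.
\<close>

lemma compact_op_apply_weakly_seq_continuous_iff:
  fixes e :: "'b::real_normed_vector"
  assumes e: "e \<noteq> 0"
  shows "weakly_seq_continuous2 (compact_op_apply :: ('a::real_normed_vector \<Rightarrow>\<^sub>K 'b) \<Rightarrow> 'a \<Rightarrow> 'b)
    \<longleftrightarrow> weakly_seq_continuous2 (blinfun_apply :: ('a \<Rightarrow>\<^sub>L real) \<Rightarrow> 'a \<Rightarrow> real)"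
proof
  assume B: "weakly_seq_continuous2 (compact_op_apply :: ('a \<Rightarrow>\<^sub>K 'b) \<Rightarrow> 'a \<Rightarrow> 'b)"
  obtain \<psi> :: "'b \<Rightarrow>\<^sub>L real" where \<psi>: "\<psi> e = norm e"
    by (rule ex_norming_functional)
  show "weakly_seq_continuous2 (blinfun_apply :: ('a \<Rightarrow>\<^sub>L real) \<Rightarrow> 'a \<Rightarrow> real)"
    unfolding weakly_seq_continuous2_def weakly_tendsto_real
  proof (intro allI impI)
    fix \<phi> \<phi>' and x :: "nat \<Rightarrow> 'a" and x'
    assume \<phi>: "weakly_tendsto \<phi> (\<phi>' :: 'a \<Rightarrow>\<^sub>L real)" and x: "weakly_tendsto x x'"
    have "weakly_tendsto (\<lambda>n. compact_op_apply (rank_one (\<phi> n) e) (x n))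
            (compact_op_apply (rank_one \<phi>' e) x')"
      using B weakly_tendsto_bounded_linear[OF bounded_linear_rank_one \<phi>, of e] x
      unfolding weakly_seq_continuous2_def by blast
    then have "(\<lambda>n. \<psi> (\<phi> n (x n) *\<^sub>R e)) \<longlonglongrightarrow> \<psi> (\<phi>' x' *\<^sub>R e)"
      by (simp add: weakly_tendsto_iff compact_op_apply_rank_one)
    then have "(\<lambda>n. \<phi> n (x n) * norm e) \<longlonglongrightarrow> \<phi>' x' * norm e"
      by (simp add: blinfun.scaleR_right \<psi>)
    then show "(\<lambda>n. \<phi> n (x n)) \<longlonglongrightarrow> \<phi>' x'"
      using e by (simp add: tendsto_mult_right_iff)
  qed
next
  assume P: "weakly_seq_continuous2 (blinfun_apply :: ('a \<Rightarrow>\<^sub>L real) \<Rightarrow> 'a \<Rightarrow> real)"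
  show "weakly_seq_continuous2 (compact_op_apply :: ('a \<Rightarrow>\<^sub>K 'b) \<Rightarrow> 'a \<Rightarrow> 'b)"
    unfolding weakly_seq_continuous2_def
  proof (intro allI impI)
    fix X :: "nat \<Rightarrow> 'a \<Rightarrow>\<^sub>K 'b" and X' and x :: "nat \<Rightarrow> 'a" and x'
    assume X: "weakly_tendsto X X'" and x: "weakly_tendsto x x'"
    show "weakly_tendsto (\<lambda>n. compact_op_apply (X n) (x n)) (compact_op_apply X' x')"
      unfolding weakly_tendsto_iff
    proof
      fix \<psi> :: "'b \<Rightarrow>\<^sub>L real"
      have "bounded_linear (\<lambda>X :: 'a \<Rightarrow>\<^sub>K 'b. \<psi> o\<^sub>L blinfun_of_compact_op X)"
        by (rule bounded_linear_compose[OF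
              bounded_bilinear.bounded_linear_right[OF bounded_bilinear_blinfun_compose]
              bounded_linear_blinfun_of_compact_op])
      from weakly_tendsto_bounded_linear[OF this X]
      have "weakly_tendsto (\<lambda>n. (\<psi> o\<^sub>L blinfun_of_compact_op (X n)) (x n))
              ((\<psi> o\<^sub>L blinfun_of_compact_op X') x')"
        using P x unfolding weakly_seq_continuous2_def by blast
      then show "(\<lambda>n. \<psi> (compact_op_apply (X n) (x n))) \<longlonglongrightarrow> \<psi> (compact_op_apply X' x')"
        by (simp add: weakly_tendsto_real compact_op_apply_def)
    qed
  qed
qed

lemma infinite_dimensional_imp_nonzero:
  assumes "infinite_dimensional TYPE('a::real_vector)"
  shows "\<exists>e :: 'a. e \<noteq> 0"
proof -
  have "span ({} :: 'a set) \<noteq> UNIV"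
    using assms unfolding infinite_dimensional_def by blast
  then show ?thesis
    by auto
qed

section \<open>Attainment of the minimum\<close>

text \<open>
  A functional that norms \<open>x\<close> bounds the norms along the sequence from below and converges to
  \<open>norm x\<close>.
\<close>

lemma norm_weakly_lower_semicontinuous:
  fixes x :: "'a::real_normed_vector"
  assumes X: "weakly_tendsto X x" and e: "e > 0"
  shows "\<forall>\<^sub>F n in sequentially. norm x - e < norm (X n)"
proof -
  obtain \<phi> :: "'a \<Rightarrow>\<^sub>L real" where \<phi>: "norm \<phi> \<le> 1" "\<phi> x = norm x"
    by (rule ex_norming_functional)
  have le: "\<phi> y \<le> norm y" for y
    using norm_blinfun[of \<phi> y] mult_right_mono[OF \<phi>(1), of "norm y"] by simp
  have "(\<lambda>n. \<phi> (X n)) \<longlonglongrightarrow> norm x"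
    using X \<phi>(2) by (simp add: weakly_tendsto_iff flip: \<phi>(2))
  then have "\<forall>\<^sub>F n in sequentially. norm x - e < \<phi> (X n)"
    using e by (intro order_tendstoD) auto
  then show ?thesis
    by eventually_elim (use le in \<open>auto intro: less_le_trans\<close>)
qed

text \<open>
  The three sequences are eventually above \<open>a - e\<close>, \<open>b - e\<close> and \<open>c - e\<close>, so the value of \<open>f\<close> at
  these numbers is at most \<open>L\<close>, and \<open>e\<close> can tend to \<open>0\<close> by continuity. The numbers are truncated at
  \<open>0\<close> to stay in the domain of \<open>f\<close>.
\<close>

lemma increasing_continuous_le_limit:
  fixes f :: "real \<times> real \<times> real \<Rightarrow> real"
  defines "Q \<equiv> {0..} \<times> {0..} \<times> {0..}"
  assumes cont: "continuous_on Q f"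
    and mono: "\<And>s t u s' t' u'. 0 \<le> s \<Longrightarrow> s \<le> s' \<Longrightarrow> 0 \<le> t \<Longrightarrow> t \<le> t' \<Longrightarrow> 0 \<le> u \<Longrightarrow> u \<le> u'
            \<Longrightarrow> f (s, t, u) \<le> f (s', t', u')"
    and nonneg: "0 \<le> a" "0 \<le> b" "0 \<le> c" "\<And>n. 0 \<le> s n" "\<And>n. 0 \<le> t n" "\<And>n. 0 \<le> u n"
    and s: "\<And>e. e > 0 \<Longrightarrow> \<forall>\<^sub>F n in sequentially. a - e < s n"
    and t: "\<And>e. e > 0 \<Longrightarrow> \<forall>\<^sub>F n in sequentially. b - e < t n"
    and u: "\<And>e. e > 0 \<Longrightarrow> \<forall>\<^sub>F n in sequentially. c - e < u n"
    and lim: "(\<lambda>n. f (s n, t n, u n)) \<longlonglongrightarrow> L"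
  shows "f (a, b, c) \<le> L"
proof -
  define p where "p e = (max 0 (a - e), max 0 (b - e), max 0 (c - e))" for e
  have below: "f (p e) \<le> L" if "e > 0" for e
  proof (rule tendsto_lowerbound[OF lim])
    show "\<forall>\<^sub>F n in sequentially. f (p e) \<le> f (s n, t n, u n)"
      using s[OF that] t[OF that] u[OF that]
    proof eventually_elim
      case (elim n)
      then show ?case
        unfolding p_def using nonneg(4-6)[of n] by (intro mono) auto
    qed
  qed simp
  have "(\<lambda>n. p (inverse (real (Suc n)))) \<longlonglongrightarrow> (max 0 (a - 0), max 0 (b - 0), max 0 (c - 0))"
    unfolding p_def by (intro tendsto_intros LIMSEQ_inverse_real_of_nat)
  then have "(\<lambda>n. p (inverse (real (Suc n)))) \<longlonglongrightarrow> (a, b, c)"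
    using nonneg by simp
  then have "(\<lambda>n. f (p (inverse (real (Suc n))))) \<longlonglongrightarrow> f (a, b, c)"
    by (rule continuous_on_tendsto_compose[OF cont]) (use nonneg in \<open>auto simp: Q_def p_def\<close>)
  then show ?thesis
    by (rule LIMSEQ_le_const2) (use below in \<open>auto intro!: exI[of _ 0]\<close>)
qed

lemma minimum_attained_weakly_compact:
  fixes B :: "'a::real_normed_vector \<Rightarrow> 'b::real_normed_vector \<Rightarrow> 'c::real_normed_vector"
    and T :: "'b \<Rightarrow>\<^sub>L 'd::real_normed_vector"
    and f :: "real \<times> real \<times> real \<Rightarrow> real"
  assumes B: "weakly_seq_continuous2 B"
    and C: "C \<noteq> {}" "weakly_compact C" and D: "D \<noteq> {}" "weakly_compact D"
    and f: "f \<in> {0..} \<times> {0..} \<times> {0..} \<rightarrow> {0..}" "continuous_on ({0..} \<times> {0..} \<times> {0..}) f"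
    and mono: "\<And>t u. 0 \<le> t \<Longrightarrow> 0 \<le> u \<Longrightarrow> mono_on {0..} (\<lambda>s. f (s, t, u))"
      "\<And>s u. 0 \<le> s \<Longrightarrow> 0 \<le> u \<Longrightarrow> mono_on {0..} (\<lambda>t. f (s, t, u))"
      "\<And>s t. 0 \<le> s \<Longrightarrow> 0 \<le> t \<Longrightarrow> mono_on {0..} (\<lambda>u. f (s, t, u))"
  shows "\<exists>X\<in>C. \<exists>x\<in>D. \<forall>Y\<in>C. \<forall>y\<in>D.
    f (norm (T x), norm (A - X), norm (B X x - b)) \<le> f (norm (T y), norm (A - Y), norm (B Y y - b))"
proof -
  define v where "v X x = f (norm (T x), norm (A - X), norm (B X x - b))" for X x
  define V where "V = {v X x | X x. X \<in> C \<and> x \<in> D}"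
  have V: "V \<noteq> {}" "bdd_below V"
    using C(1) D(1) f(1) by (auto simp: V_def v_def intro!: bdd_belowI[of _ 0])
  then have "Inf V \<in> closure V"
    by (rule closure_contains_Inf)
  then obtain a where a: "\<And>n. a n \<in> V" "a \<longlonglongrightarrow> Inf V"
    unfolding closure_sequential by auto
  then have "\<forall>n. \<exists>X x. a n = v X x \<and> X \<in> C \<and> x \<in> D"
    by (auto simp: V_def)
  then obtain X x where Xx: "\<And>n. a n = v (X n) (x n)" "\<And>n. X n \<in> C" "\<And>n. x n \<in> D"
    by metis
  obtain X' and r :: "nat \<Rightarrow> nat"
    where r: "X' \<in> C" "strict_mono r" "weakly_tendsto (X \<circ> r) X'"
    by (rule Eberlein_Smulian[OF C(2) Xx(2)])
  obtain x' and q :: "nat \<Rightarrow> nat"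
    where q: "x' \<in> D" "strict_mono q" "weakly_tendsto ((x \<circ> r) \<circ> q) x'"
    by (rule Eberlein_Smulian[OF D(2), of "x \<circ> r"]) (use Xx(3) in auto)
  define k where "k = r \<circ> q"
  have X: "weakly_tendsto (\<lambda>n. X (k n)) X'" and x: "weakly_tendsto (\<lambda>n. x (k n)) x'"
    using limitin_subsequence[OF q(2) r(3)] q(3) by (simp_all add: k_def o_def)
  have "v X' x' \<le> Inf V"
    unfolding v_def
  proof (rule increasing_continuous_le_limit[OF f(2)])
    show "f (s, t, u) \<le> f (s', t', u')"
      if "0 \<le> s" "s \<le> s'" "0 \<le> t" "t \<le> t'" "0 \<le> u" "u \<le> u'" for s t u s' t' u'
    proof -
      have "f (s, t, u) \<le> f (s', t, u)"
        using that by (intro mono_onD[OF mono(1)]) auto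
      also have "\<dots> \<le> f (s', t', u)"
        using that by (intro mono_onD[OF mono(2)]) auto
      also have "\<dots> \<le> f (s', t', u')"
        using that by (intro mono_onD[OF mono(3)]) auto
      finally show ?thesis .
    qed
    fix e :: real assume e: "e > 0"
    show "\<forall>\<^sub>F n in sequentially. norm (T x') - e < norm (T (x (k n)))"
      by (intro norm_weakly_lower_semicontinuous e
            weakly_tendsto_bounded_linear[OF blinfun.bounded_linear_right x])
    show "\<forall>\<^sub>F n in sequentially. norm (A - X') - e < norm (A - X (k n))"
      by (intro norm_weakly_lower_semicontinuous e weakly_tendsto_diff weakly_tendsto_const X)
    have "weakly_tendsto (\<lambda>n. B (X (k n)) (x (k n))) (B X' x')"
      using B X x unfolding weakly_seq_continuous2_def by blast
    then show "\<forall>\<^sub>F n in sequentially. norm (B X' x' - b) - e < norm (B (X (k n)) (x (k n)) - b)"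
      by (intro norm_weakly_lower_semicontinuous e weakly_tendsto_diff weakly_tendsto_const)
  next
    have "(a \<circ> k) \<longlonglongrightarrow> Inf V"
      using a(2) strict_mono_o[OF r(2) q(2)] unfolding k_def by (rule LIMSEQ_subseq_LIMSEQ)
    then show "(\<lambda>n. f (norm (T (x (k n))), norm (A - X (k n)), norm (B (X (k n)) (x (k n)) - b)))
        \<longlonglongrightarrow> Inf V"
      by (simp add: o_def Xx(1) v_def)
  qed auto
  moreover have "Inf V \<le> v Y y" if "Y \<in> C" "y \<in> D" for Y y
    using that V(2) by (intro cInf_lower) (auto simp: V_def)
  ultimately show ?thesis
    using r(1) q(1) unfolding v_def by (meson order_trans)
qed

theorem proposition5p6:
  assumes "infinite_dimensional TYPE('e0::banach)"
    and "infinite_dimensional TYPE('e1::banach)"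
    and "infinite_dimensional TYPE('e2::banach)"
  shows "(weakly_seq_continuous2
            (compact_op_apply :: ('e0 \<Rightarrow>\<^sub>K 'e1) \<Rightarrow> 'e0 \<Rightarrow> 'e1)
          \<longleftrightarrow> dunford_pettis TYPE('e0))
    \<and> (dunford_pettis TYPE('e0) \<longrightarrow>
        (\<forall>(C :: ('e0 \<Rightarrow>\<^sub>K 'e1) set) (D :: 'e0 set) (A :: 'e0 \<Rightarrow>\<^sub>K 'e1) (T :: 'e0 \<Rightarrow>\<^sub>L 'e2) (b :: 'e1)
            (f :: real \<times> real \<times> real \<Rightarrow> real).
          C \<noteq> {} \<longrightarrow> closed C \<longrightarrow> convex C \<longrightarrow> weakly_compact C \<longrightarrow>
          D \<noteq> {} \<longrightarrow> closed D \<longrightarrow> convex D \<longrightarrow> weakly_compact D \<longrightarrow>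
          A \<in> C \<longrightarrow>
          f \<in> {0..} \<times> {0..} \<times> {0..} \<rightarrow> {0..} \<longrightarrow>
          continuous_on ({0..} \<times> {0..} \<times> {0..}) f \<longrightarrow>
          (\<forall>t\<ge>0. \<forall>u\<ge>0. mono_on {0..} (\<lambda>s. f (s, t, u))) \<longrightarrow>
          (\<forall>s\<ge>0. \<forall>u\<ge>0. mono_on {0..} (\<lambda>t. f (s, t, u))) \<longrightarrow>
          (\<forall>s\<ge>0. \<forall>t\<ge>0. mono_on {0..} (\<lambda>u. f (s, t, u))) \<longrightarrow>
          filterlim f at_top (inf at_infinity (principal ({0..} \<times> {0..} \<times> {0..}))) \<longrightarrow>
          (\<exists>X\<in>C. \<exists>x\<in>D. \<forall>Y\<in>C. \<forall>y\<in>D.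
             f (norm (blinfun_apply T x), norm (A - X), norm (compact_op_apply X x - b))
             \<le> f (norm (blinfun_apply T y), norm (A - Y), norm (compact_op_apply Y y - b)))))"
proof -
  obtain e :: 'e1 where "e \<noteq> 0"
    using infinite_dimensional_imp_nonzero[OF assms(2)] by blast
  then have iff: "weakly_seq_continuous2 (compact_op_apply :: ('e0 \<Rightarrow>\<^sub>K 'e1) \<Rightarrow> 'e0 \<Rightarrow> 'e1)
      \<longleftrightarrow> dunford_pettis TYPE('e0)"
    unfolding dunford_pettis_iff_pairing_weakly_seq_continuous
    by (rule compact_op_apply_weakly_seq_continuous_iff)
  show ?thesis
    using iff by (intro conjI impI allI minimum_attained_weakly_compact) auto
qed

end
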